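(* Let $(M,L)$ be a Finsler manifold and let $L\to\overline{L}=e^{\sigma}L+\beta$, $\beta=b_i(x)y^i$, be a $\beta$-conformal change. Then the torsion tensors of the Cartan connections of $(M,L)$ and $(M,\overline{L})$ are related as follows: (a) $\overline{C}^i_{jk}=C^i_{jk}+A^i_{jk}$, (b) $\overline{P}^i_{jk}=P^i_{jk}-D^i_{jk}+B^i_{jk}$, (c) $\overline{R}^i_{jk}=R^i_{jk}+\mathfrak{U}_{j,k}\big(D^i_{0j|k}-(B^i_{jr}+P^i_{jr})D^r_{0k}\big)$, where $\mathfrak{U}_{j,k}(Q_{jk}):=Q_{jk}-Q_{kj}$, $B^i_{jk}:=\dot\partial_kD^i_{0j}$, $$A^i_{jk}=\frac{1}{2\overline{L}}\big(h_{jk}m^i+h_j{}^i m_k+h_k{}^i m_j\big)-\frac{1}{\tau}C_{jks}L^ib^s-\frac{1}{2\overline{L}\tau}\big(2m_jm_k+m^2h_{jk}\big)L^i,\qquad \tau=e^{\sigma}\frac{\overline{L}}{L},$$ and $D^i_{0j}$, $D^i_{jk}$ are given by $$D^i_{jk}=L H^i{}_{jk}+\frac{L}{\overline{L}}(H_{jk}-L H_{\beta jk})L^i,\qquad D^i_{0j}=L\,G^i{}_j+\frac{L}{\overline{L}}(G_j-L G_{\beta j})L^i,$$ $$H_{ijk}=\tfrac12\big(L_{jkr}D^r_{0i}-L_{ijr}D^r_{0k}-L_{ikr}D^r_{0j}+\sigma_jL_{ik}+\sigma_kL_{ij}-\sigma_iL_{jk}\big),$$ $$H_{ij}=E_{ij}-\tfrac12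 e^{\sigma}\big(L_{ir}D^r_{0j}+L_{jr}D^r_{0i}-\sigma_{ij}\big),$$ $$G_{ij}=e^{-\sigma}F_{ij}-\tfrac12 L_{ijr}D^r_{00}+\tfrac12(\sigma_0L_{ij}-\mu_{ij}),\qquad G_i=E_{0i}-\tfrac12 e^{\sigma}L_{ir}D^r_{00}+\tfrac12 e^{\sigma}(\sigma_0L_i+\sigma_iL),$$ $$D^r_{00}=2Le^{-\sigma}F^r_0+\frac{L}{\overline{L}}(E_{00}-2Le^{-\sigma}F_{\beta0})L^r-L^2\sigma^r+\frac{L}{\overline{L}}(2Le^{\sigma}\sigma_0+L^2\sigma_\beta)L^r.$$
   Context: $M$ is an $n$-dimensional $C^\infty$ manifold, $L(x,y)$ a Finsler metric function; all objects are considered in local coordinates $(x^i,y^i)$ at $y\neq0$. A $\beta$-conformal change is $L\to\overline{L}=e^{\sigma}L+\beta$, with $\sigma$ a smooth function on $M$ and $\beta=b_i(x)y^i$ a 1-form on $M$; $\overline{L}$ is assumed to be a Finsler metric function too. $\partial_i=\partial/\partial x^i$, $\dot\partial_i=\partial/\partial y^i$; summation convention; the index $0$ denotes contraction with $y$ (e.g. $F_{i0}=F_{ij}y^j$, $E_{0i}=E_{ji}y^j$, $\sigma_0=\sigma_jy^j$). Notation for $(M,L)$: $g_{ij}=\frac12\dot\partial_i\dot\partial_jL^2$ with inverse $g^{ij}$; $L_i=\dot\partial_iL$, $L^i=y^i/L$; $L_{ij}=\dot\partial_jL_i$, $L_{ijk}=\dot\partial_kL_{ij}$; $h_{ij}=LL_{ij}=g_{ij}-L_iL_j$,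 $h_j{}^i=g^{ik}h_{jk}$; $C_{ijk}=\frac12\dot\partial_kg_{ij}$, $C^i_{jk}=g^{il}C_{ljk}$. Cartan connection: $N^i_j=\frac12\dot\partial_jS^i$ with $S^i=\frac12g^{ir}(y^k\partial_k\dot\partial_rL^2-\partial_rL^2)$, $\delta_k=\partial_k-N^r_k\dot\partial_r$, $\Gamma^i_{jk}=\frac12g^{ir}(\delta_jg_{rk}+\delta_kg_{rj}-\delta_rg_{jk})$ (symmetric in $j,k$, with $y^k\Gamma^i_{jk}=N^i_j$). Torsion tensors: $C^i_{jk}$, $P^i_{jk}=\dot\partial_kN^i_j-\Gamma^i_{jk}$, $R^i_{jk}=\delta_kN^i_j-\delta_jN^i_k$. Bars denote the same objects built from $\overline{L}$. The difference tensor of the two Cartan connections is $D^i_{jk}=\overline{\Gamma}^i_{jk}-\Gamma^i_{jk}$, with $D^i_{0j}=D^i_{kj}y^k$ and $D^i_{00}=D^i_{jk}y^jy^k$. The $h$-covariant derivative is $X^i_{j|k}=\delta_kX^i_j+X^r_j\Gamma^i_{rk}-X^i_r\Gamma^r_{jk}$, and for covectors $b_{i|j}=\delta_jb_i-b_r\Gamma^r_{ij}$. Further: $m_i=b_i-\frac{\beta}{L}L_i$, $m^i=g^{ik}m_k$, $m^2=m_im^i$; $\sigma_i=\partial_i\sigma$, $\sigma^r=g^{ri}\sigma_i$, $b^i=g^{ij}b_j$, $\sigma_\beta=\sigma_ib^i$, $E_{ij}=\frac12(b_{i|j}+b_{j|i})$, $F_{ij}=\frac12(b_{i|j}-b_{j|i})$,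 $F^r_0=g^{ir}F_{i0}$, $F_{\beta0}=F_{i0}b^i$, $\sigma_{ij}=\sigma_iL_j+\sigma_jL_i$, $\mu_{ij}=\sigma_iL_j-\sigma_jL_i$; $G^i{}_j=g^{ir}G_{rj}$, $G_{\beta j}=b^iG_{ij}$, $H^i{}_{jk}=g^{ir}H_{rjk}$, $H_{\beta jk}=b^iH_{ijk}$.
   Formalization: In A^i_jk the coefficients 1/τ and 1/(2L̄τ) of the second and third terms are replaced by e^σ/τ and e^σ/(2L̄τ); as printed, (a) fails, e.g. for Euclidean L (n≥2), constant σ≠0 and small constant b≠0. *)

theory Defs
  imports "HOL-Analysis.Analysis"
begin

section \<open>Smooth manifolds in local coordinates\<close>

text \<open>Functions of class \<open>C\<^sup>k\<close> and \<open>C\<^sup>\<infinity>\<close> on an open subset of a (finite-dimensional) space.\<close>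

primrec Ck_on ::
  "nat \<Rightarrow> 'a::real_normed_vector set \<Rightarrow> ('a \<Rightarrow> 'b::real_normed_vector) \<Rightarrow> bool" where
  "Ck_on 0 S f \<longleftrightarrow> continuous_on S f"
| "Ck_on (Suc k) S f \<longleftrightarrow> (\<forall>x\<in>S. f differentiable (at x)) \<and>
     (\<forall>v. Ck_on k S (\<lambda>x. frechet_derivative f (at x) v))"

definition smooth_on :: "'a::real_normed_vector set \<Rightarrow> ('a \<Rightarrow> 'b::real_normed_vector) \<Rightarrow> bool" where
  "smooth_on S f \<longleftrightarrow> (\<forall>k. Ck_on k S f)"

text \<open>A chart is a pair \<open>(U, \<phi>)\<close>; the values of \<open>\<phi>\<close> outside \<open>U\<close> are irrelevant.\<close>

type_synonym ('m, 'n) chart = "'m set \<times> ('m \<Rightarrow> real ^ 'n)"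

definition chart_image :: "('m, 'n::finite) chart \<Rightarrow> (real ^ 'n) set" where
  "chart_image c = snd c ` fst c"

definition chart_inv :: "('m, 'n::finite) chart \<Rightarrow> real ^ 'n \<Rightarrow> 'm" where
  "chart_inv c = inv_into (fst c) (snd c)"

definition chart_overlap :: "('m, 'n::finite) chart \<Rightarrow> ('m, 'n) chart \<Rightarrow> (real ^ 'n) set" where
  "chart_overlap c d = snd c ` (fst c \<inter> fst d)"

definition transition :: "('m, 'n::finite) chart \<Rightarrow> ('m, 'n) chart \<Rightarrow> real ^ 'n \<Rightarrow> real ^ 'n" where
  "transition c d = snd d \<circ> chart_inv c"

definition smooth_manifold ::
  "('m::{t2_space, second_countable_topology}, 'n::finite) chart set \<Rightarrow> bool" where
  "smooth_manifold \<A> \<longleftrightarrow>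
     (\<Union>c\<in>\<A>. fst c) = UNIV \<and>
     (\<forall>c\<in>\<A>. open (fst c) \<and> open (chart_image c) \<and>
        homeomorphism (fst c) (chart_image c) (snd c) (chart_inv c)) \<and>
     (\<forall>c\<in>\<A>. \<forall>d\<in>\<A>. smooth_on (chart_overlap c d) (transition c d))"

definition in_chart :: "('m \<Rightarrow> real) \<Rightarrow> ('m, 'n::finite) chart \<Rightarrow> real ^ 'n \<Rightarrow> real" where
  "in_chart f c = f \<circ> chart_inv c"

definition smooth_function :: "('m, 'n::finite) chart set \<Rightarrow> ('m \<Rightarrow> real) \<Rightarrow> bool" where
  "smooth_function \<A> f \<longleftrightarrow> (\<forall>c\<in>\<A>. smooth_on (chart_image c) (in_chart f c))"

text \<open>A 1-form is given by its component functions \<open>b\<^sub>i\<close> in every chart, subject to the covector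
  transformation law.\<close>

definition smooth_one_form ::
  "('m, 'n::finite) chart set \<Rightarrow> (('m, 'n) chart \<Rightarrow> real ^ 'n \<Rightarrow> real ^ 'n) \<Rightarrow> bool" where
  "smooth_one_form \<A> b \<longleftrightarrow>
     (\<forall>c\<in>\<A>. smooth_on (chart_image c) (b c)) \<and>
     (\<forall>c\<in>\<A>. \<forall>d\<in>\<A>. \<forall>x\<in>chart_overlap c d. \<forall>v.
        b c x \<bullet> v = b d (transition c d x) \<bullet> frechet_derivative (transition c d) (at x) v)"


section \<open>Finsler geometry in a chart\<close>

text \<open>Points \<open>(x, y)\<close> of the tangent bundle over a chart domain.  A tensor field is given by its
  components, which are real functions of \<open>(x, y)\<close>; contravariant indices are listed first.\<close>

type_synonym 'n tpoint = "(real ^ 'n) \<times> (real ^ 'n)"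
type_synonym 'n scalar = "'n tpoint \<Rightarrow> real"

definition dx :: "'n::finite \<Rightarrow> 'n scalar \<Rightarrow> 'n scalar" where
  "dx i f p = frechet_derivative f (at p) (axis i 1, 0)"

definition dy :: "'n::finite \<Rightarrow> 'n scalar \<Rightarrow> 'n scalar" where
  "dy i f p = frechet_derivative f (at p) (0, axis i 1)"

definition ycomp :: "'n::finite \<Rightarrow> 'n scalar" where
  "ycomp i p = snd p $ i"

definition L1 :: "'n::finite scalar \<Rightarrow> 'n \<Rightarrow> 'n scalar" where
  "L1 L i = dy i L"

definition L2 :: "'n::finite scalar \<Rightarrow> 'n \<Rightarrow> 'n \<Rightarrow> 'n scalar" where
  "L2 L i j = dy j (L1 L i)"

definition L3 :: "'n::finite scalar \<Rightarrow> 'n \<Rightarrow> 'n \<Rightarrow> 'n \<Rightarrow> 'n scalar" where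
  "L3 L i j k = dy k (L2 L i j)"

definition Lup :: "'n::finite scalar \<Rightarrow> 'n \<Rightarrow> 'n scalar" where
  "Lup L i p = ycomp i p / L p"

definition metric :: "'n::finite scalar \<Rightarrow> 'n \<Rightarrow> 'n \<Rightarrow> 'n scalar" where
  "metric L i j p = 1/2 * dy i (dy j (\<lambda>q. (L q)\<^sup>2)) p"

definition metric_inv :: "'n::finite scalar \<Rightarrow> 'n \<Rightarrow> 'n \<Rightarrow> 'n scalar" where
  "metric_inv L i j p = matrix_inv (\<chi> a b. metric L a b p) $ i $ j"

definition angular :: "'n::finite scalar \<Rightarrow> 'n \<Rightarrow> 'n \<Rightarrow> 'n scalar" where
  "angular L i j p = L p * L2 L i j p"

text \<open>\<open>angular_mixed L i j\<close> is \<open>h\<^sub>j\<^sup>i = g\<^sup>i\<^sup>k h\<^sub>j\<^sub>k\<close>.\<close>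

definition angular_mixed :: "'n::finite scalar \<Rightarrow> 'n \<Rightarrow> 'n \<Rightarrow> 'n scalar" where
  "angular_mixed L i j p = (\<Sum>k\<in>UNIV. metric_inv L i k p * angular L j k p)"

definition cartan_low :: "'n::finite scalar \<Rightarrow> 'n \<Rightarrow> 'n \<Rightarrow> 'n \<Rightarrow> 'n scalar" where
  "cartan_low L i j k p = 1/2 * dy k (metric L i j) p"

definition cartan :: "'n::finite scalar \<Rightarrow> 'n \<Rightarrow> 'n \<Rightarrow> 'n \<Rightarrow> 'n scalar" where
  "cartan L i j k p = (\<Sum>l\<in>UNIV. metric_inv L i l p * cartan_low L l j k p)"

definition spray :: "'n::finite scalar \<Rightarrow> 'n \<Rightarrow> 'n scalar" where
  "spray L i p = 1/2 * (\<Sum>r\<in>UNIV. metric_inv L i r p *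
     ((\<Sum>k\<in>UNIV. ycomp k p * dx k (dy r (\<lambda>q. (L q)\<^sup>2)) p) - dx r (\<lambda>q. (L q)\<^sup>2) p))"

definition nonlin :: "'n::finite scalar \<Rightarrow> 'n \<Rightarrow> 'n \<Rightarrow> 'n scalar" where
  "nonlin L i j p = 1/2 * dy j (spray L i) p"

definition hderiv :: "'n::finite scalar \<Rightarrow> 'n \<Rightarrow> 'n scalar \<Rightarrow> 'n scalar" where
  "hderiv L k f p = dx k f p - (\<Sum>r\<in>UNIV. nonlin L r k p * dy r f p)"

definition Gam :: "'n::finite scalar \<Rightarrow> 'n \<Rightarrow> 'n \<Rightarrow> 'n \<Rightarrow> 'n scalar" where
  "Gam L i j k p = 1/2 * (\<Sum>r\<in>UNIV. metric_inv L i r p *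
     (hderiv L j (metric L r k) p + hderiv L k (metric L r j) p - hderiv L r (metric L j k) p))"

definition Ptors :: "'n::finite scalar \<Rightarrow> 'n \<Rightarrow> 'n \<Rightarrow> 'n \<Rightarrow> 'n scalar" where
  "Ptors L i j k p = dy k (nonlin L i j) p - Gam L i j k p"

definition Rtors :: "'n::finite scalar \<Rightarrow> 'n \<Rightarrow> 'n \<Rightarrow> 'n \<Rightarrow> 'n scalar" where
  "Rtors L i j k p = hderiv L k (nonlin L i j) p - hderiv L j (nonlin L i k) p"

text \<open>\<open>hcov L X i j k\<close> is \<open>X\<^sup>i\<^sub>j\<^sub>|\<^sub>k\<close>, and \<open>hcov_form L w i j\<close> is \<open>w\<^sub>i\<^sub>|\<^sub>j\<close>.\<close>

definition hcov ::
  "'n::finite scalar \<Rightarrow> ('n \<Rightarrow> 'n \<Rightarrow> 'n scalar) \<Rightarrow> 'n \<Rightarrow> 'n \<Rightarrow> 'n \<Rightarrow> 'n scalar" where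
  "hcov L X i j k p = hderiv L k (X i j) p
     + (\<Sum>r\<in>UNIV. X r j p * Gam L i r k p) - (\<Sum>r\<in>UNIV. X i r p * Gam L r j k p)"

definition hcov_form ::
  "'n::finite scalar \<Rightarrow> ('n \<Rightarrow> 'n scalar) \<Rightarrow> 'n \<Rightarrow> 'n \<Rightarrow> 'n scalar" where
  "hcov_form L w i j p = hderiv L j (w i) p - (\<Sum>r\<in>UNIV. w r p * Gam L r i j p)"

text \<open>A Finsler metric function, given by its local expressions \<open>L c (x, y)\<close> in every chart \<open>c\<close>;
  the compatibility condition says that they define one function on the tangent bundle.
  Homogeneity forces \<open>L c (x, 0) = 0\<close>.\<close>

definition finsler_metric ::
  "('m, 'n::finite) chart set \<Rightarrow> (('m, 'n) chart \<Rightarrow> 'n scalar) \<Rightarrow> bool" where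
  "finsler_metric \<A> L \<longleftrightarrow>
     (\<forall>c\<in>\<A>. \<forall>d\<in>\<A>. \<forall>x\<in>chart_overlap c d. \<forall>v.
        L c (x, v) = L d (transition c d x, frechet_derivative (transition c d) (at x) v)) \<and>
     (\<forall>c\<in>\<A>.
        smooth_on (chart_image c \<times> (UNIV - {0})) (L c) \<and>
        (\<forall>x\<in>chart_image c. \<forall>y. y \<noteq> 0 \<longrightarrow> L c (x, y) > 0) \<and>
        (\<forall>x\<in>chart_image c. \<forall>y. \<forall>t>0. L c (x, t *\<^sub>R y) = t * L c (x, y)) \<and>
        (\<forall>x\<in>chart_image c. \<forall>y. y \<noteq> 0 \<longrightarrow>
           (\<forall>v. v \<noteq> 0 \<longrightarrow> (\<Sum>i\<in>UNIV. \<Sum>j\<in>UNIV. metric (L c) i j (x, y) * v $ i * v $ j) > 0)))"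


section \<open>The \<open>\<beta>\<close>-conformal change\<close>

text \<open>Everything below lives in one chart: \<open>L\<close> is the local expression of the Finsler metric,
  \<open>\<sigma>\<close> that of the conformal factor and \<open>b\<close> the components of the 1-form.\<close>

context
  fixes L :: "'n::finite scalar" and \<sigma> :: "real ^ 'n \<Rightarrow> real" and b :: "real ^ 'n \<Rightarrow> real ^ 'n"
begin

definition blow :: "'n \<Rightarrow> 'n scalar" where
  "blow i p = b (fst p) $ i"

definition beta :: "'n scalar" where
  "beta p = (\<Sum>i\<in>UNIV. blow i p * ycomp i p)"

definition esig :: "'n scalar" where
  "esig p = exp (\<sigma> (fst p))"

definition Lbar :: "'n scalar" where
  "Lbar p = esig p * L p + beta p"

definition Diff :: "'n \<Rightarrow> 'n \<Rightarrow> 'n \<Rightarrow> 'n scalar" where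
  "Diff i j k p = Gam Lbar i j k p - Gam L i j k p"

definition Diff0 :: "'n \<Rightarrow> 'n \<Rightarrow> 'n scalar" where
  "Diff0 i j p = (\<Sum>k\<in>UNIV. Diff i k j p * ycomp k p)"

definition Diff00 :: "'n \<Rightarrow> 'n scalar" where
  "Diff00 i p = (\<Sum>j\<in>UNIV. \<Sum>k\<in>UNIV. Diff i j k p * ycomp j p * ycomp k p)"

definition Btens :: "'n \<Rightarrow> 'n \<Rightarrow> 'n \<Rightarrow> 'n scalar" where
  "Btens i j k = dy k (Diff0 i j)"

definition mlow :: "'n \<Rightarrow> 'n scalar" where
  "mlow i p = blow i p - beta p / L p * L1 L i p"

definition mup :: "'n \<Rightarrow> 'n scalar" where
  "mup i p = (\<Sum>k\<in>UNIV. metric_inv L i k p * mlow k p)"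

definition msq :: "'n scalar" where
  "msq p = (\<Sum>i\<in>UNIV. mlow i p * mup i p)"

definition bup :: "'n \<Rightarrow> 'n scalar" where
  "bup i p = (\<Sum>j\<in>UNIV. metric_inv L i j p * blow j p)"

definition siglow :: "'n \<Rightarrow> 'n scalar" where
  "siglow i = dx i (\<lambda>q. \<sigma> (fst q))"

definition sigup :: "'n \<Rightarrow> 'n scalar" where
  "sigup r p = (\<Sum>i\<in>UNIV. metric_inv L r i p * siglow i p)"

definition sig0 :: "'n scalar" where
  "sig0 p = (\<Sum>j\<in>UNIV. siglow j p * ycomp j p)"

definition sigbeta :: "'n scalar" where
  "sigbeta p = (\<Sum>i\<in>UNIV. siglow i p * bup i p)"

definition sigsym :: "'n \<Rightarrow> 'n \<Rightarrow> 'n scalar" where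
  "sigsym i j p = siglow i p * L1 L j p + siglow j p * L1 L i p"

definition musk :: "'n \<Rightarrow> 'n \<Rightarrow> 'n scalar" where
  "musk i j p = siglow i p * L1 L j p - siglow j p * L1 L i p"

definition Elow :: "'n \<Rightarrow> 'n \<Rightarrow> 'n scalar" where
  "Elow i j p = 1/2 * (hcov_form L blow i j p + hcov_form L blow j i p)"

definition Flow :: "'n \<Rightarrow> 'n \<Rightarrow> 'n scalar" where
  "Flow i j p = 1/2 * (hcov_form L blow i j p - hcov_form L blow j i p)"

text \<open>\<open>E0 i\<close> is \<open>E\<^sub>0\<^sub>i\<close>, but \<open>F0 i\<close> is \<open>F\<^sub>i\<^sub>0\<close> (the skew tensor is contracted in its second index).\<close>

definition E0 :: "'n \<Rightarrow> 'n scalar" where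
  "E0 i p = (\<Sum>j\<in>UNIV. Elow j i p * ycomp j p)"

definition E00 :: "'n scalar" where
  "E00 p = (\<Sum>i\<in>UNIV. \<Sum>j\<in>UNIV. Elow i j p * ycomp i p * ycomp j p)"

definition F0 :: "'n \<Rightarrow> 'n scalar" where
  "F0 i p = (\<Sum>j\<in>UNIV. Flow i j p * ycomp j p)"

definition F0up :: "'n \<Rightarrow> 'n scalar" where
  "F0up r p = (\<Sum>i\<in>UNIV. metric_inv L i r p * F0 i p)"

definition Fbeta0 :: "'n scalar" where
  "Fbeta0 p = (\<Sum>i\<in>UNIV. F0 i p * bup i p)"

definition tau :: "'n scalar" where
  "tau p = esig p * Lbar p / L p"

text \<open>In \<open>\<tau> = e\<^sup>\<sigma> \<^bold>L/L\<close>, with \<open>\<^bold>L = e\<^sup>\<sigma> L + \<beta>\<close>, the coefficients \<open>e\<^sup>\<sigma>/\<tau>\<close> of the last two terms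
  below equal \<open>L/\<^bold>L\<close>.  The source prints \<open>1/\<tau>\<close> in both places, dropping the factor \<open>e\<^sup>\<sigma>\<close>.  That
  version is false: \<open>C\<^sup>i\<^sub>j\<^sub>k\<close> does not change under a constant rescaling of the metric, so for constant
  \<open>\<sigma>\<close> the pairs \<open>(\<sigma>, b)\<close> and \<open>(0, e\<^sup>-\<^sup>\<sigma> b)\<close> must give the same tensor, which holds only with the
  factor \<open>e\<^sup>\<sigma>\<close> present.\<close>

definition Atens :: "'n \<Rightarrow> 'n \<Rightarrow> 'n \<Rightarrow> 'n scalar" where
  "Atens i j k p =
     1 / (2 * Lbar p) * (angular L j k p * mup i p + angular_mixed L i j p * mlow k p
        + angular_mixed L i k p * mlow j p)
     - esig p / tau p * (\<Sum>s\<in>UNIV. cartan_low L j k s p * Lup L i p * bup s p)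
     - esig p / (2 * Lbar p * tau p)
        * (2 * mlow j p * mlow k p + msq p * angular L j k p) * Lup L i p"

definition Glow :: "'n \<Rightarrow> 'n \<Rightarrow> 'n scalar" where
  "Glow i j p = exp (- \<sigma> (fst p)) * Flow i j p
     - 1/2 * (\<Sum>r\<in>UNIV. L3 L i j r p * Diff00 r p)
     + 1/2 * (sig0 p * L2 L i j p - musk i j p)"

definition G1 :: "'n \<Rightarrow> 'n scalar" where
  "G1 i p = E0 i p - 1/2 * esig p * (\<Sum>r\<in>UNIV. L2 L i r p * Diff00 r p)
     + 1/2 * esig p * (sig0 p * L1 L i p + siglow i p * L p)"

definition Gup :: "'n \<Rightarrow> 'n \<Rightarrow> 'n scalar" where
  "Gup i j p = (\<Sum>r\<in>UNIV. metric_inv L i r p * Glow r j p)"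

definition Gbeta :: "'n \<Rightarrow> 'n scalar" where
  "Gbeta j p = (\<Sum>i\<in>UNIV. bup i p * Glow i j p)"

definition H3 :: "'n \<Rightarrow> 'n \<Rightarrow> 'n \<Rightarrow> 'n scalar" where
  "H3 i j k p = 1/2 *
     ((\<Sum>r\<in>UNIV. L3 L j k r p * Diff0 r i p)
      - (\<Sum>r\<in>UNIV. L3 L i j r p * Diff0 r k p)
      - (\<Sum>r\<in>UNIV. L3 L i k r p * Diff0 r j p)
      + siglow j p * L2 L i k p + siglow k p * L2 L i j p - siglow i p * L2 L j k p)"

definition H2 :: "'n \<Rightarrow> 'n \<Rightarrow> 'n scalar" where
  "H2 i j p = Elow i j p - 1/2 * esig p *
     ((\<Sum>r\<in>UNIV. L2 L i r p * Diff0 r j p) + (\<Sum>r\<in>UNIV. L2 L j r p * Diff0 r i p)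
      - sigsym i j p)"

definition Hup :: "'n \<Rightarrow> 'n \<Rightarrow> 'n \<Rightarrow> 'n scalar" where
  "Hup i j k p = (\<Sum>r\<in>UNIV. metric_inv L i r p * H3 r j k p)"

definition Hbeta :: "'n \<Rightarrow> 'n \<Rightarrow> 'n scalar" where
  "Hbeta j k p = (\<Sum>i\<in>UNIV. bup i p * H3 i j k p)"

text \<open>The explicit expressions for \<open>D\<^sup>i\<^sub>j\<^sub>k\<close>, \<open>D\<^sup>i\<^sub>0\<^sub>j\<close> and \<open>D\<^sup>i\<^sub>0\<^sub>0\<close>; each one involves only the
  contractions determined by the later ones.\<close>

definition Diff_expr :: "'n \<Rightarrow> 'n \<Rightarrow> 'n \<Rightarrow> 'n scalar" where
  "Diff_expr i j k p = L p * Hup i j k p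
     + L p / Lbar p * (H2 j k p - L p * Hbeta j k p) * Lup L i p"

definition Diff0_expr :: "'n \<Rightarrow> 'n \<Rightarrow> 'n scalar" where
  "Diff0_expr i j p = L p * Gup i j p
     + L p / Lbar p * (G1 j p - L p * Gbeta j p) * Lup L i p"

definition Diff00_expr :: "'n \<Rightarrow> 'n scalar" where
  "Diff00_expr r p = 2 * L p * exp (- \<sigma> (fst p)) * F0up r p
     + L p / Lbar p * (E00 p - 2 * L p * exp (- \<sigma> (fst p)) * Fbeta0 p) * Lup L r p
     - (L p)\<^sup>2 * sigup r p
     + L p / Lbar p * (2 * L p * esig p * sig0 p + (L p)\<^sup>2 * sigbeta p) * Lup L r p"

end

definition beta_conformal_change ::
  "('m \<Rightarrow> real) \<Rightarrow> (('m, 'n::finite) chart \<Rightarrow> real ^ 'n \<Rightarrow> real ^ 'n)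
    \<Rightarrow> (('m, 'n) chart \<Rightarrow> 'n scalar) \<Rightarrow> ('m, 'n) chart \<Rightarrow> 'n scalar" where
  "beta_conformal_change \<sigma> b L c = Lbar (L c) (in_chart \<sigma> c) (b c)"

text \<open>The operator \<open>\<UU>\<^sub>j\<^sub>,\<^sub>k\<close>.\<close>

definition alternate :: "('n \<Rightarrow> 'n \<Rightarrow> real) \<Rightarrow> 'n \<Rightarrow> 'n \<Rightarrow> real" where
  "alternate Q j k = Q j k - Q k j"

end

(*
  Both Cartan connections are characterized by delta_k L_i = L_r Gamma^r_ik and
  delta_k L_ij = L_rj Gamma^r_ik + L_ir Gamma^r_jk, the first-order form of metricity.  Because b_i and
  sigma do not depend on y, the barred L_ij and L_ijk are e^sigma times the unbarred ones, so subtracting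
  the two sets of equations gives a linear system L_ir X^r = Q_i, Lbar_r X^r = k for X = D^r_jk.  The
  form L_ij has kernel spanned by y and Lbar_r y^r = Lbar > 0, so such a system has exactly one
  solution, given by an explicit formula.  The contractions D^i_0j, D^i_00 and the barred Cartan
  tensor (which satisfies Lbar_r X^r = 0) solve systems of the same shape.  The laws for P and R come
  from substituting N + D_0 for the barred nonlinear connection in the definitions.
*)
theory Submission
  imports Defs
begin

section \<open>Directional derivatives and smooth functions\<close>

text \<open>The explicit formulas look circular, since the one for D^i_jk contains D^i_0j and the
  one for D^i_0j contains D^i_00. Homogeneity breaks the circle: L_ij y^j = 0 and L_ijk y^k = -L_ij,
  so contracting a system with y lowers its right side by one level, and at D^i_00 the only unknown
  left on the right is half of the left side and is absorbed by it. One thing is lost on the way: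
  the contracted L_ij equations fix only the symmetric part of L_ir D^r_0k. The skew part comes from
  the L_i equation, whose left side is symmetric in its free indices. This is where F_ij enters,
  while E_ij comes from the symmetric part. The first-order equations are not given:
  \<open>Gam\<close> is built from \<open>nonlin\<close>, which is built from \<open>spray\<close>,
  so y^k Gamma^i_jk = N^i_j and N^i_j y^j = S^i have to be derived first, by contracting identities
  with lowered indices. Smoothness has to be carried along throughout, because
  \<open>frechet_derivative\<close> has no useful value at a point of non-differentiability; the
  delicate case is the inverse metric.\<close>

abbreviation dird :: "'a::real_normed_vector \<Rightarrow> ('a \<Rightarrow> 'b::real_normed_vector) \<Rightarrow> 'a \<Rightarrow> 'b" where
  "dird v f p \<equiv> frechet_derivative f (at p) v"

lemma dird_eq: "(f has_derivative f') (at p) \<Longrightarrow> dird v f p = f' v"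
  using frechet_derivative_at by metis

lemma has_derivative_dird: "f differentiable (at p) \<Longrightarrow> (f has_derivative (\<lambda>v. dird v f p)) (at p)"
  by (simp add: frechet_derivative_works)

lemma dird_cong:
  assumes "open S" "p \<in> S" "\<And>q. q \<in> S \<Longrightarrow> f q = g q"
  shows "dird v f p = dird v g p"
proof (cases "f differentiable (at p)")
  case True
  then show ?thesis
    using frechet_derivative_transform_within_open[OF True assms(1,2)] assms(3) by metis
next
  case False
  \<comment> \<open>Both functions have the same derivatives at \<open>p\<close>, so the choice
    operator behind \<open>frechet_derivative\<close> returns the same value for both even when no
    derivative exists.\<close>
  have "(f has_derivative D) (at p) = (g has_derivative D) (at p)" for D
    using has_derivative_transform_within_open[of f D p UNIV S g]
      has_derivative_transform_within_open[of g D p UNIV S f] assms by auto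
  then show ?thesis
    by (simp add: frechet_derivative_def)
qed

lemma dird_add:
  assumes "f differentiable (at p)" "g differentiable (at p)"
  shows "dird v (\<lambda>x. f x + g x) p = dird v f p + dird v g p"
  using has_derivative_add[OF assms[THEN has_derivative_dird]] dird_eq by metis

lemma dird_diff:
  assumes "f differentiable (at p)" "g differentiable (at p)"
  shows "dird v (\<lambda>x. f x - g x) p = dird v f p - dird v g p"
  using has_derivative_diff[OF assms[THEN has_derivative_dird]] dird_eq by metis

lemma dird_mult:
  fixes f g :: "'a::real_normed_vector \<Rightarrow> real"
  assumes "f differentiable (at p)" "g differentiable (at p)"
  shows "dird v (\<lambda>x. f x * g x) p = f p * dird v g p + dird v f p * g p"
  using dird_eq[OF has_derivative_mult[OF assms[THEN has_derivative_dird]]] by simp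

lemma dird_cmult:
  fixes f :: "'a::real_normed_vector \<Rightarrow> real"
  assumes "f differentiable (at p)"
  shows "dird v (\<lambda>x. c * f x) p = c * dird v f p"
  using dird_mult[of "\<lambda>x. c" p f v] assms by simp

lemma dird_sum:
  assumes "\<And>i. i \<in> I \<Longrightarrow> f i differentiable (at p)"
  shows "dird v (\<lambda>x. \<Sum>i\<in>I. f i x) p = (\<Sum>i\<in>I. dird v (f i) p)"
  using has_derivative_sum[of I f "\<lambda>i v. dird v (f i) p" "at p"] assms
  by (intro dird_eq) (simp add: has_derivative_dird)

lemma dird_linear:
  assumes "f differentiable (at p)"
  shows "dird (u + v) f p = dird u f p + dird v f p"
    and "dird (c *\<^sub>R v) f p = c *\<^sub>R dird v f p"
    and "dird (\<Sum>i\<in>I. w i) f p = (\<Sum>i\<in>I. dird (w i) f p)"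
  using linear_frechet_derivative[OF assms]
  by (auto simp: linear_add linear_cmul linear_sum)

section \<open>Closure properties of \<open>Ck_on\<close>\<close>

lemma Ck_on_SucD: "Ck_on (Suc k) S f \<Longrightarrow> Ck_on k S f"
proof (induction k arbitrary: f)
  case 0
  then show ?case
    by (auto intro!: continuous_at_imp_continuous_on differentiable_imp_continuous_within)
next
  case (Suc k)
  then show ?case by auto
qed

lemma Ck_on_cong:
  assumes "open S" "\<And>x. x \<in> S \<Longrightarrow> f x = g x" "Ck_on k S f"
  shows "Ck_on k S g"
  using assms(2,3)
proof (induction k arbitrary: f g)
  case 0
  then show ?case
    using continuous_on_cong by fastforce
next
  case (Suc k)
  have "g differentiable (at x)" if "x \<in> S" for x
  proof -
    have "(f has_derivative (\<lambda>v. dird v f x)) (at x)"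
      using Suc.prems(2) that by (simp add: has_derivative_dird)
    then have "(g has_derivative (\<lambda>v. dird v f x)) (at x)"
      using Suc.prems(1) assms(1) that by (simp add: has_derivative_transform_within_open)
    then show ?thesis
      by (rule differentiableI)
  qed
  moreover have "Ck_on k S (\<lambda>x. dird v g x)" for v
  proof (rule Suc.IH)
    show "dird v f x = dird v g x" if "x \<in> S" for x
      using assms(1) that Suc.prems(1) by (rule dird_cong)
    show "Ck_on k S (\<lambda>x. dird v f x)"
      using Suc.prems(2) by simp
  qed
  ultimately show ?case by simp
qed

text \<open>\<open>Ck_on\<close> speaks of the chosen derivative \<open>frechet_derivative\<close>.
  On an open set any formula \<open>f'\<close> for the derivative may replace it, which is the form
  that the product, quotient and chain rules deliver.\<close>

lemma Ck_on_SucI: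
  assumes "open S" "\<And>x. x \<in> S \<Longrightarrow> (f has_derivative f' x) (at x)"
    "\<And>v. Ck_on k S (\<lambda>x. f' x v)"
  shows "Ck_on (Suc k) S f"
proof -
  have "Ck_on k S (\<lambda>x. dird v f x)" for v
  proof (rule Ck_on_cong[OF assms(1) _ assms(3)])
    show "f' x v = dird v f x" if "x \<in> S" for x
      using dird_eq[OF assms(2)[OF that]] by metis
  qed
  then show ?thesis
    using assms(2) by (auto intro: differentiableI)
qed

lemma Ck_on_has_derivative:
  "Ck_on (Suc k) S f \<Longrightarrow> x \<in> S \<Longrightarrow> (f has_derivative (\<lambda>v. dird v f x)) (at x)"
  by (simp add: has_derivative_dird)

lemma Ck_on_dird: "Ck_on (Suc k) S f \<Longrightarrow> Ck_on k S (\<lambda>x. dird v f x)"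
  by simp

lemma Ck_on_const: "Ck_on k S (\<lambda>x. c)"
proof (induction k arbitrary: c)
  case (Suc k)
  then show ?case by simp
qed simp

lemma Ck_on_add:
  assumes "open S" "Ck_on k S f" "Ck_on k S g"
  shows "Ck_on k S (\<lambda>x. f x + g x)"
  using assms(2,3)
proof (induction k arbitrary: f g)
  case (Suc k)
  show ?case
    by (rule Ck_on_SucI[OF assms(1)])
      (rule has_derivative_add Suc.IH Suc.prems[THEN Ck_on_has_derivative] Suc.prems[THEN Ck_on_dird]
        | assumption)+
qed (auto intro: continuous_on_add)

lemma Ck_on_mult:
  fixes f g :: "'a::real_normed_vector \<Rightarrow> real"
  assumes "open S" "Ck_on k S f" "Ck_on k S g"
  shows "Ck_on k S (\<lambda>x. f x * g x)"
  using assms(2,3)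
proof (induction k arbitrary: f g)
  case (Suc k)
  show ?case
    by (rule Ck_on_SucI[OF assms(1)])
      (rule has_derivative_mult Ck_on_add assms(1) Suc.IH Suc.prems[THEN Ck_on_has_derivative]
        Suc.prems[THEN Ck_on_dird] Suc.prems[THEN Ck_on_SucD] | assumption)+
qed (auto intro: continuous_on_mult)

lemma Ck_on_inverse:
  fixes f :: "'a::real_normed_vector \<Rightarrow> real"
  assumes "open S" "Ck_on k S f" "\<And>x. x \<in> S \<Longrightarrow> f x \<noteq> 0"
  shows "Ck_on k S (\<lambda>x. inverse (f x))"
  using assms(2)
proof (induction k)
  case 0
  then show ?case using assms(3) by (auto intro: continuous_on_inverse)
next
  case (Suc k)
  have inv: "Ck_on k S (\<lambda>x. inverse (f x))"
    by (rule Suc.IH[OF Ck_on_SucD[OF Suc.prems]])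
  show ?case
  proof (rule Ck_on_SucI[OF assms(1)])
    \<comment> \<open>The sign is written as a factor \<open>- 1\<close>, so that the derivative is
      a plain product and \<open>Ck_on_mult\<close> with \<open>Ck_on_const\<close> covers
      it.\<close>
    show "((\<lambda>x. inverse (f x)) has_derivative (\<lambda>v. - 1 * (inverse (f x) * dird v f x * inverse (f x)))) (at x)"
      if "x \<in> S" for x
      using Deriv.has_derivative_inverse[OF assms(3)[OF that] Ck_on_has_derivative[OF Suc.prems that]]
      by simp
    show "Ck_on k S (\<lambda>x. - 1 * (inverse (f x) * dird v f x * inverse (f x)))" for v
      by (intro Ck_on_mult Ck_on_const inv assms(1) Ck_on_dird[OF Suc.prems])
  qed
qed

lemma Ck_on_exp:
  fixes f :: "'a::real_normed_vector \<Rightarrow> real"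
  assumes "open S" "Ck_on k S f"
  shows "Ck_on k S (\<lambda>x. exp (f x))"
  using assms(2)
proof (induction k)
  case 0
  then show ?case by (auto intro: continuous_on_exp)
next
  case (Suc k)
  show ?case
  proof (rule Ck_on_SucI[OF assms(1)])
    show "((\<lambda>x. exp (f x)) has_derivative (\<lambda>v. exp (f x) * dird v f x)) (at x)" if "x \<in> S" for x
      using Ck_on_has_derivative[OF Suc.prems that] by (auto intro!: derivative_eq_intros)
    show "Ck_on k S (\<lambda>x. exp (f x) * dird v f x)" for v
      by (intro Ck_on_mult assms(1) Suc.IH Ck_on_dird[OF Suc.prems] Ck_on_SucD[OF Suc.prems])
  qed
qed

lemma Ck_on_bounded_linear:
  assumes "open S" "bounded_linear h" "Ck_on k S f"
  shows "Ck_on k S (\<lambda>x. h (f x))"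
  using assms(3)
proof (induction k arbitrary: f)
  case 0
  then show ?case
    using assms(2) by (simp add: bounded_linear.continuous_on)
next
  case (Suc k)
  show ?case
  proof (rule Ck_on_SucI[OF assms(1)])
    show "((\<lambda>x. h (f x)) has_derivative (\<lambda>v. h (dird v f x))) (at x)" if "x \<in> S" for x
      using bounded_linear.has_derivative[OF assms(2) Ck_on_has_derivative[OF Suc.prems that]] .
    show "Ck_on k S (\<lambda>x. h (dird v f x))" for v
      by (rule Suc.IH[OF Ck_on_dird[OF Suc.prems]])
  qed
qed

text \<open>Since \<open>fst\<close> is linear, the chain rule returns a function of the same shape
  and the induction closes on itself. This makes sigma and b smooth as functions on the tangent
  bundle.\<close>

lemma Ck_on_compose_fst:
  fixes f :: "'a::real_normed_vector \<Rightarrow> 'b::real_normed_vector"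
    and S :: "('a \<times> 'c::real_normed_vector) set"
  assumes "open S" "fst ` S \<subseteq> U" "Ck_on k U f"
  shows "Ck_on k S (\<lambda>p. f (fst p))"
  using assms(3)
proof (induction k arbitrary: f)
  case 0
  then show ?case
    using assms(2) by (auto intro!: continuous_on_compose2[of U f] continuous_on_fst)
next
  case (Suc k)
  show ?case
  proof (rule Ck_on_SucI[OF assms(1)])
    show "((\<lambda>p. f (fst p)) has_derivative (\<lambda>v. dird (fst v) f (fst p))) (at p)" if "p \<in> S" for p
    proof -
      have "fst p \<in> U" using that assms(2) by auto
      from diff_chain_at[OF has_derivative_fst[OF has_derivative_ident]
          Ck_on_has_derivative[OF Suc.prems this]]
      show ?thesis by (simp add: o_def)
    qed
    show "Ck_on k S (\<lambda>p. dird (fst v) f (fst p))" for v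
      by (rule Suc.IH[OF Ck_on_dird[OF Suc.prems]])
  qed
qed

lemma Ck_on_id: "Ck_on k S (\<lambda>x. x)"
  by (cases k) (auto simp: Ck_on_const)

section \<open>The same closure properties for smooth functions, collected as introduction
  rules\<close>

named_theorems smooth_intros

lemma smooth_on_differentiable: "smooth_on S f \<Longrightarrow> p \<in> S \<Longrightarrow> f differentiable (at p)"
  using Ck_on.simps(2)[of 0 S f] by (auto simp: smooth_on_def)

lemma smooth_on_dird [smooth_intros]: "smooth_on S f \<Longrightarrow> smooth_on S (\<lambda>x. dird v f x)"
  unfolding smooth_on_def by (metis Ck_on.simps(2))

lemma smooth_on_cong:
  "open S \<Longrightarrow> (\<And>x. x \<in> S \<Longrightarrow> f x = g x) \<Longrightarrow> smooth_on S f \<Longrightarrow> smooth_on S g"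
  unfolding smooth_on_def by (metis Ck_on_cong)

lemma smooth_on_const [smooth_intros]: "smooth_on S (\<lambda>x. c)"
  by (simp add: smooth_on_def Ck_on_const)

lemma smooth_on_add [smooth_intros]:
  "open S \<Longrightarrow> smooth_on S f \<Longrightarrow> smooth_on S g \<Longrightarrow> smooth_on S (\<lambda>x. f x + g x)"
  by (simp add: smooth_on_def Ck_on_add)

lemma smooth_on_mult [smooth_intros]:
  fixes f g :: "'a::real_normed_vector \<Rightarrow> real"
  shows "open S \<Longrightarrow> smooth_on S f \<Longrightarrow> smooth_on S g \<Longrightarrow> smooth_on S (\<lambda>x. f x * g x)"
  by (simp add: smooth_on_def Ck_on_mult)

lemma smooth_on_diff [smooth_intros]:
  fixes f g :: "'a::real_normed_vector \<Rightarrow> real"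
  shows "open S \<Longrightarrow> smooth_on S f \<Longrightarrow> smooth_on S g \<Longrightarrow> smooth_on S (\<lambda>x. f x - g x)"
  using smooth_on_add[of S f "\<lambda>x. -1 * g x"] smooth_on_mult[OF _ smooth_on_const, of S g "-1"] by simp

lemma smooth_on_divide [smooth_intros]:
  fixes f g :: "'a::real_normed_vector \<Rightarrow> real"
  shows "open S \<Longrightarrow> smooth_on S f \<Longrightarrow> smooth_on S g \<Longrightarrow> (\<And>x. x \<in> S \<Longrightarrow> g x \<noteq> 0) \<Longrightarrow>
    smooth_on S (\<lambda>x. f x / g x)"
  by (simp add: smooth_on_def Ck_on_mult Ck_on_inverse divide_inverse)

lemma smooth_on_power2 [smooth_intros]:
  fixes f :: "'a::real_normed_vector \<Rightarrow> real"
  shows "open S \<Longrightarrow> smooth_on S f \<Longrightarrow> smooth_on S (\<lambda>x. (f x)\<^sup>2)"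
  by (simp add: power2_eq_square smooth_on_mult)

lemma smooth_on_exp [smooth_intros]:
  fixes f :: "'a::real_normed_vector \<Rightarrow> real"
  shows "open S \<Longrightarrow> smooth_on S f \<Longrightarrow> smooth_on S (\<lambda>x. exp (f x))"
  by (simp add: smooth_on_def Ck_on_exp)

lemma smooth_on_sum [smooth_intros]:
  fixes f :: "'i \<Rightarrow> 'a::real_normed_vector \<Rightarrow> real"
  shows "open S \<Longrightarrow> (\<And>i. i \<in> I \<Longrightarrow> smooth_on S (f i)) \<Longrightarrow> smooth_on S (\<lambda>x. \<Sum>i\<in>I. f i x)"
  by (induction I rule: infinite_finite_induct) (auto intro!: smooth_intros)

lemma smooth_on_prod [smooth_intros]:
  fixes f :: "'i \<Rightarrow> 'a::real_normed_vector \<Rightarrow> real"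
  shows "open S \<Longrightarrow> (\<And>i. i \<in> I \<Longrightarrow> smooth_on S (f i)) \<Longrightarrow> smooth_on S (\<lambda>x. \<Prod>i\<in>I. f i x)"
  by (induction I rule: infinite_finite_induct) (auto intro!: smooth_intros)

lemma smooth_on_bounded_linear:
  "open S \<Longrightarrow> bounded_linear h \<Longrightarrow> smooth_on S f \<Longrightarrow> smooth_on S (\<lambda>x. h (f x))"
  by (simp add: smooth_on_def Ck_on_bounded_linear)

lemma smooth_on_compose_fst:
  "open S \<Longrightarrow> fst ` S \<subseteq> U \<Longrightarrow> smooth_on U f \<Longrightarrow> smooth_on S (\<lambda>p. f (fst p))"
  by (simp add: smooth_on_def Ck_on_compose_fst)

section \<open>Determinants and inverse matrices with smooth entries\<close>

lemma smooth_on_det: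
  fixes A :: "'a::real_normed_vector \<Rightarrow> real ^ 'n ^ 'n"
  assumes "open S" "\<And>i j. smooth_on S (\<lambda>x. A x $ i $ j)"
  shows "smooth_on S (\<lambda>x. det (A x))"
  unfolding det_def using assms by (intro smooth_intros) auto

lemma matrix_inv_mult:
  fixes A :: "real ^ 'n ^ 'n"
  assumes "invertible A"
  shows "A ** matrix_inv A = mat 1" "matrix_inv A ** A = mat 1"
proof -
  have "\<exists>B. A ** B = mat 1 \<and> B ** A = mat 1"
    using assms by (simp add: invertible_def)
  from someI_ex[OF this] show "A ** matrix_inv A = mat 1" "matrix_inv A ** A = mat 1"
    by (simp_all add: matrix_inv_def)
qed

text \<open>Column \<open>j\<close> of the inverse solves A v = e_j, so Cramer's rule applies. The
  point is to have each entry as a quotient of polynomials in the entries of \<open>A\<close>, from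
  which smoothness can be read off.\<close>

lemma matrix_inv_cramer:
  fixes A :: "real ^ 'n ^ 'n"
  assumes "invertible A"
  shows "matrix_inv A $ i $ j =
    det (\<chi> a c. if c = i then (if a = j then 1 else 0) else A $ a $ c) / det A"
proof -
  have "A *v (\<chi> k. matrix_inv A $ k $ j) = (\<chi> a. if a = j then 1 else 0)"
    using matrix_inv_mult(1)[OF assms]
    by (simp add: vec_eq_iff matrix_matrix_mult_def matrix_vector_mult_def mat_def)
  moreover have "det A \<noteq> 0" using assms invertible_det_nz by blast
  ultimately have "(\<chi> k. matrix_inv A $ k $ j) =
      (\<chi> k. det (\<chi> a c. if c = k then (\<chi> a. if a = j then 1 else 0) $ a else A $ a $ c) / det A)"
    by (simp add: cramer)
  then have "matrix_inv A $ i $ j =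
      det (\<chi> a c. if c = i then (\<chi> a. if a = j then 1 else 0) $ a else A $ a $ c) / det A"
    by (simp add: vec_eq_iff)
  then show ?thesis by (simp cong: if_cong)
qed

lemma smooth_on_matrix_inv:
  fixes A :: "'a::real_normed_vector \<Rightarrow> real ^ 'n ^ 'n"
  assumes "open S" "\<And>i j. smooth_on S (\<lambda>x. A x $ i $ j)" "\<And>x. x \<in> S \<Longrightarrow> invertible (A x)"
  shows "smooth_on S (\<lambda>x. matrix_inv (A x) $ i $ j)"
proof (rule smooth_on_cong[OF assms(1)])
  show "smooth_on S (\<lambda>x. det (\<chi> a c. if c = i then (if a = j then 1 else 0) else A x $ a $ c) / det (A x))"
  proof (intro smooth_intros smooth_on_det assms)
    show "det (A x) \<noteq> 0" if "x \<in> S" for x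
      using assms(3)[OF that] invertible_det_nz by blast
    show "smooth_on S (\<lambda>x. (\<chi> a c. if c = i then (if a = j then 1 else 0) else A x $ a $ c) $ ia $ ja)"
      for ia ja
      using assms(2) by (cases "ja = i") (auto intro: smooth_intros)
  qed
  show "det (\<chi> a c. if c = i then (if a = j then 1 else 0) else A x $ a $ c) / det (A x)
      = matrix_inv (A x) $ i $ j" if "x \<in> S" for x
    using matrix_inv_cramer[OF assms(3)[OF that]] by simp
qed

section \<open>Symmetry of second derivatives\<close>

lemma second_difference_mvt:
  fixes f :: "'a::real_normed_vector \<Rightarrow> real"
  assumes "h > 0"
    and sub: "\<And>s t. 0 \<le> s \<Longrightarrow> s \<le> h \<Longrightarrow> 0 \<le> t \<Longrightarrow> t \<le> h \<Longrightarrow> p + s *\<^sub>R u + t *\<^sub>R v \<in> S"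
    and f: "\<And>q. q \<in> S \<Longrightarrow> f differentiable (at q)"
    and fu: "\<And>q. q \<in> S \<Longrightarrow> (\<lambda>x. dird u f x) differentiable (at q)"
  shows "\<exists>s t. 0 \<le> s \<and> s \<le> h \<and> 0 \<le> t \<and> t \<le> h \<and>
    f (p + h *\<^sub>R u + h *\<^sub>R v) - f (p + h *\<^sub>R u) - f (p + h *\<^sub>R v) + f p
      = h\<^sup>2 * dird v (\<lambda>x. dird u f x) (p + s *\<^sub>R u + t *\<^sub>R v)"
proof -
  \<comment> \<open>The mean value theorem is used twice: along \<open>u\<close> for this increment
    of \<open>f\<close> in direction \<open>v\<close>, then along \<open>v\<close> for the
    derivative in direction \<open>u\<close> that results.\<close>
  define \<phi> where "\<phi> s = f (p + s *\<^sub>R u + h *\<^sub>R v) - f (p + s *\<^sub>R u)" for s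
  have curve: "((\<lambda>s. f (q + s *\<^sub>R w)) has_real_derivative dird w f (q + s *\<^sub>R w)) (at s)"
    if "f differentiable (at (q + s *\<^sub>R w))" for f :: "'a \<Rightarrow> real" and q w s
  proof -
    have "((\<lambda>s. q + s *\<^sub>R w) has_derivative (\<lambda>t. t *\<^sub>R w)) (at s)"
      by (auto intro!: derivative_eq_intros)
    from diff_chain_at[OF this has_derivative_dird[OF that]] show ?thesis
      by (auto simp: o_def has_field_derivative_def dird_linear[OF that] mult_commute_abs)
  qed
  have "(\<phi> has_real_derivative dird u f (p + s *\<^sub>R u + h *\<^sub>R v) - dird u f (p + s *\<^sub>R u)) (at s)"
    if "0 \<le> s" "s \<le> h" for s
    unfolding \<phi>_def
    using curve[of f "p + h *\<^sub>R v" s u] curve[of f p s u] f sub[OF that, of h] sub[OF that, of 0] assms(1)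
    by (auto intro!: derivative_eq_intros simp: algebra_simps)
  from MVT2[OF assms(1) this] obtain s where s: "0 < s" "s < h"
    "\<phi> h - \<phi> 0 = h * (dird u f (p + s *\<^sub>R u + h *\<^sub>R v) - dird u f (p + s *\<^sub>R u))"
    by auto
  have "((\<lambda>t. dird u f ((p + s *\<^sub>R u) + t *\<^sub>R v)) has_real_derivative
      dird v (\<lambda>x. dird u f x) ((p + s *\<^sub>R u) + t *\<^sub>R v)) (at t)" if "0 \<le> t" "t \<le> h" for t
    using that s sub by (intro curve fu) auto
  from MVT2[OF assms(1) this] obtain t where t: "0 < t" "t < h"
    "dird u f (p + s *\<^sub>R u + h *\<^sub>R v) - dird u f (p + s *\<^sub>R u)
      = h * dird v (\<lambda>x. dird u f x) (p + s *\<^sub>R u + t *\<^sub>R v)"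
    by auto
  show ?thesis
    using s t by (intro exI[of _ s] exI[of _ t]) (auto simp: \<phi>_def power2_eq_square algebra_simps)
qed

text \<open>Schwarz's theorem: both iterated derivatives are limits of the same second difference quotient.\<close>

lemma dird_commute:
  fixes f :: "'a::real_normed_vector \<Rightarrow> real"
  assumes "open S" "smooth_on S f" "p \<in> S"
  shows "dird v (\<lambda>x. dird u f x) p = dird u (\<lambda>x. dird v f x) p"
proof (rule ccontr)
  let ?a = "\<lambda>q. dird v (\<lambda>x. dird u f x) q" and ?b = "\<lambda>q. dird u (\<lambda>x. dird v f x) q"
  assume neq: "?a p \<noteq> ?b p"
  \<comment> \<open>Half of the gap: a common value within \<open>e\<close> of both limits would
    make the gap smaller than \<open>2 * e\<close>, which is the gap itself.\<close>
  define e where "e = \<bar>?a p - ?b p\<bar> / 2"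
  have "e > 0" using neq by (simp add: e_def)
  have "isCont ?a p" "isCont ?b p"
    using assms by (auto intro!: differentiable_imp_continuous_within smooth_on_differentiable[of S] smooth_intros)
  with \<open>e > 0\<close> obtain d1 d2 where d: "d1 > 0" "\<And>q. dist q p < d1 \<Longrightarrow> dist (?a q) (?a p) < e"
      "d2 > 0" "\<And>q. dist q p < d2 \<Longrightarrow> dist (?b q) (?b p) < e"
    unfolding continuous_at_eps_delta by (metis dist_commute)
  obtain d3 where d3: "d3 > 0" "ball p d3 \<subseteq> S"
    using assms openE by blast
  define r where "r = min d1 (min d2 d3)"
  \<comment> \<open>Small enough that the parallelogram spanned by \<open>h *\<^sub>R u\<close> and
    \<open>h *\<^sub>R v\<close> at \<open>p\<close> stays within distance \<open>r\<close>; the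
    \<open>+ 1\<close> keeps the denominator positive when both directions vanish.\<close>
  define h where "h = r / (2 * (norm u + norm v + 1))"
  have "r > 0" using d d3 by (simp add: r_def)
  then have "h > 0" by (simp add: h_def add_nonneg_pos)
  have near: "dist (p + s *\<^sub>R u + t *\<^sub>R v) p < r" if "0 \<le> s" "s \<le> h" "0 \<le> t" "t \<le> h" for s t
  proof -
    have "dist (p + s *\<^sub>R u + t *\<^sub>R v) p \<le> s * norm u + t * norm v"
      using that norm_triangle_ineq[of "s *\<^sub>R u" "t *\<^sub>R v"] by (simp add: dist_norm)
    also have "\<dots> \<le> h * norm u + h * norm v"
      using that by (intro add_mono mult_right_mono) auto
    also have "\<dots> < h * (2 * (norm u + norm v + 1))"
      using \<open>h > 0\<close> by (simp add: algebra_simps add_nonneg_pos)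
    also have "\<dots> = r"
      by (simp add: h_def add_nonneg_eq_0_iff)
    finally show ?thesis .
  qed
  have sub: "p + s *\<^sub>R u + t *\<^sub>R v \<in> S" "p + t *\<^sub>R v + s *\<^sub>R u \<in> S"
    if "0 \<le> s" "s \<le> h" "0 \<le> t" "t \<le> h" for s t
    using near[OF that] d3 by (auto simp: r_def dist_commute algebra_simps)
  have diffs: "f differentiable (at q)" "(\<lambda>x. dird w f x) differentiable (at q)" if "q \<in> S" for q w
    using assms that by (auto intro!: smooth_on_differentiable[of S] smooth_intros)
  obtain s t where st: "0 \<le> s" "s \<le> h" "0 \<le> t" "t \<le> h"
    "f (p + h *\<^sub>R u + h *\<^sub>R v) - f (p + h *\<^sub>R u) - f (p + h *\<^sub>R v) + f p
      = h\<^sup>2 * ?a (p + s *\<^sub>R u + t *\<^sub>R v)"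
    using second_difference_mvt[where S = S and f = f, OF \<open>h > 0\<close> sub(1) diffs(1) diffs(2)] by blast
  \<comment> \<open>The second difference is symmetric in \<open>u\<close> and \<open>v\<close>, so
    exchanging them yields the other mixed derivative at a second point of the same
    parallelogram.\<close>
  obtain s' t' where st': "0 \<le> s'" "s' \<le> h" "0 \<le> t'" "t' \<le> h"
    "f (p + h *\<^sub>R v + h *\<^sub>R u) - f (p + h *\<^sub>R v) - f (p + h *\<^sub>R u) + f p
      = h\<^sup>2 * ?b (p + t' *\<^sub>R v + s' *\<^sub>R u)"
    using second_difference_mvt[where S = S and f = f and u = v and v = u, OF \<open>h > 0\<close> sub(2) diffs(1) diffs(2)]
    by blast
  have "h\<^sup>2 * ?a (p + s *\<^sub>R u + t *\<^sub>R v) = h\<^sup>2 * ?b (p + s' *\<^sub>R u + t' *\<^sub>R v)"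
    using st(5) st'(5) by (simp add: algebra_simps)
  then have "?a (p + s *\<^sub>R u + t *\<^sub>R v) = ?b (p + s' *\<^sub>R u + t' *\<^sub>R v)"
    using \<open>h > 0\<close> by simp
  moreover have "dist (?a (p + s *\<^sub>R u + t *\<^sub>R v)) (?a p) < e"
    using near[OF st(1-4)] by (intro d) (simp add: r_def)
  moreover have "dist (?b (p + s' *\<^sub>R u + t' *\<^sub>R v)) (?b p) < e"
    using near[OF st'(1-4)] by (intro d) (simp add: r_def)
  moreover have "\<bar>a - b\<bar> < 2 * e" if "c = d" "dist c a < e" "dist d b < e" for a b c d :: real
    using that by (auto simp: dist_real_def)
  ultimately have "\<bar>?a p - ?b p\<bar> < 2 * e"
    by blast
  then show False
    by (simp add: e_def)
qed

section \<open>Finsler geometry on a coordinate domain\<close>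

lemma smooth_on_dx [smooth_intros]: "smooth_on S f \<Longrightarrow> smooth_on S (dx i f)"
  using smooth_on_dird[of S f] unfolding dx_def .

lemma smooth_on_dy [smooth_intros]: "smooth_on S f \<Longrightarrow> smooth_on S (dy i f)"
  using smooth_on_dird[of S f] unfolding dy_def .

lemma bounded_linear_ycomp: "bounded_linear (ycomp i)"
  unfolding ycomp_def
  by (rule bounded_linear_compose[OF bounded_linear_vec_nth bounded_linear_snd])

lemma dird_ycomp [simp]: "dird v (ycomp i) p = snd v $ i"
  using dird_eq[OF bounded_linear_imp_has_derivative[OF bounded_linear_ycomp]]
  by (simp add: ycomp_def)

lemma smooth_on_ycomp [smooth_intros]: "open S \<Longrightarrow> smooth_on S (ycomp i)"
  using smooth_on_bounded_linear[OF _ bounded_linear_ycomp, of S "\<lambda>x. x"]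
  by (simp add: smooth_on_def Ck_on_id)

lemma dird_pair:
  fixes f :: "'n::finite scalar"
  assumes "f differentiable (at p)"
  shows "dird (u, v) f p = (\<Sum>i\<in>UNIV. u $ i * dx i f p) + (\<Sum>i\<in>UNIV. v $ i * dy i f p)"
proof -
  have "(u, v) = (\<Sum>i\<in>UNIV. u $ i *\<^sub>R (axis i 1, 0)) + (\<Sum>i\<in>UNIV. v $ i *\<^sub>R (0, axis i 1))"
    using basis_expansion[of u] basis_expansion[of v]
    by (simp add: prod_eq_iff fst_sum snd_sum scalar_mult_eq_scaleR)
  then show ?thesis
    by (simp only: dird_linear[OF assms] dx_def dy_def real_scaleR_def)
qed

text \<open>The horizontal lift of the \<open>k\<close>-th coordinate vector. At a fixed point
  \<open>hderiv\<close> is the directional derivative along it, so every rule for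
  \<open>dird\<close> carries over.\<close>

definition hvec :: "'n::finite scalar \<Rightarrow> 'n \<Rightarrow> 'n tpoint \<Rightarrow> 'n tpoint" where
  "hvec L k p = (axis k 1, - (\<chi> r. nonlin L r k p))"

lemma snd_hvec [simp]: "snd (hvec L k p) $ r = - nonlin L r k p"
  by (simp add: hvec_def)

lemma hderiv_dird:
  assumes "f differentiable (at p)"
  shows "hderiv L k f p = dird (hvec L k p) f p"
proof -
  have "(\<Sum>i\<in>UNIV. (axis k 1 :: real ^ 'a) $ i * dx i f p) = dx k f p"
    by (simp add: axis_def if_distrib[where f = "\<lambda>x. x * _"] cong: if_cong)
  then show ?thesis
    unfolding hvec_def dird_pair[OF assms] hderiv_def by (simp add: sum_negf)
qed

lemma dird_contract:
  fixes f :: "'n::finite \<Rightarrow> 'n scalar"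
  assumes "\<And>j. f j differentiable (at p)"
  shows "dird v (\<lambda>q. \<Sum>j\<in>UNIV. f j q * ycomp j q) p
    = (\<Sum>j\<in>UNIV. dird v (f j) p * ycomp j p) + (\<Sum>j\<in>UNIV. f j p * snd v $ j)"
proof -
  have y: "ycomp j differentiable (at p)" for j :: 'n
    using bounded_linear_imp_differentiable[OF bounded_linear_ycomp] .
  show ?thesis
    using assms y by (simp add: dird_sum dird_mult sum.distrib add.commute)
qed

lemma snd_axis_sum [simp]:
  fixes f :: "'n::finite \<Rightarrow> real"
  shows "(\<Sum>j\<in>UNIV. f j * (axis i 1 :: real ^ 'n) $ j) = f i"
  by (simp add: axis_def if_distrib[where f = "\<lambda>x. _ * x"] cong: if_cong)

text \<open>The content of \<open>finsler_metric\<close> in a single chart. The compatibility of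
  charts is absent because all computations take place in one chart.\<close>

locale finsler_domain =
  fixes U :: "(real ^ 'n::finite) set" and L :: "'n scalar"
  assumes open_base: "open U"
    and smooth_L': "smooth_on (U \<times> (UNIV - {0})) L"
    and L_pos': "\<And>x y. x \<in> U \<Longrightarrow> y \<noteq> 0 \<Longrightarrow> L (x, y) > 0"
    and L_homogeneous: "\<And>x y t. x \<in> U \<Longrightarrow> t > 0 \<Longrightarrow> L (x, t *\<^sub>R y) = t * L (x, y)"
    and metric_pos: "\<And>x y v. x \<in> U \<Longrightarrow> y \<noteq> 0 \<Longrightarrow> v \<noteq> 0 \<Longrightarrow>
      (\<Sum>i\<in>UNIV. \<Sum>j\<in>UNIV. metric L i j (x, y) * v $ i * v $ j) > 0"
begin

text \<open>The slit tangent bundle over the chart. \<open>L\<close> is assumed smooth only off the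
  zero section; openness is what allows identities valid on \<open>T\<close> to be
  differentiated.\<close>

definition T :: "'n tpoint set" where
  "T = U \<times> (UNIV - {0})"

lemma open_T [smooth_intros, simp]: "open T"
  unfolding T_def using open_base by (intro open_Times) auto

lemma smooth_L [smooth_intros, simp]: "smooth_on T L"
  using smooth_L' by (simp add: T_def)

lemma L_pos: "p \<in> T \<Longrightarrow> L p > 0"
  using L_pos' by (cases p) (auto simp: T_def)

lemma diff_T [simp]: "smooth_on T f \<Longrightarrow> p \<in> T \<Longrightarrow> f differentiable (at p)"
  by (rule smooth_on_differentiable)

lemma smooth_L1 [smooth_intros, simp]: "smooth_on T (L1 L i)"
  unfolding L1_def by (intro smooth_intros)

lemma smooth_L2 [smooth_intros, simp]: "smooth_on T (L2 L i j)"
  unfolding L2_def by (intro smooth_intros)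

lemma smooth_L3 [smooth_intros, simp]: "smooth_on T (L3 L i j k)"
  unfolding L3_def by (intro smooth_intros)

lemma smooth_metric [smooth_intros, simp]: "smooth_on T (metric L i j)"
  unfolding metric_def by (intro smooth_intros)

lemma smooth_ycomp [simp]: "smooth_on T (ycomp i)"
  by (intro smooth_intros)

section \<open>Differentiation rules on the slit tangent bundle\<close>

lemma dy_cong: "p \<in> T \<Longrightarrow> (\<And>q. q \<in> T \<Longrightarrow> f q = g q) \<Longrightarrow> dy i f p = dy i g p"
  unfolding dy_def by (rule dird_cong[OF open_T])

lemma dx_cong: "p \<in> T \<Longrightarrow> (\<And>q. q \<in> T \<Longrightarrow> f q = g q) \<Longrightarrow> dx i f p = dx i g p"
  unfolding dx_def by (rule dird_cong[OF open_T])

lemma hderiv_cong: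
  assumes "p \<in> T" "\<And>q. q \<in> T \<Longrightarrow> f q = g q"
  shows "hderiv L' i f p = hderiv L' i g p"
  using dx_cong[of p f g, OF assms] dy_cong[of p f g, OF assms] by (simp add: hderiv_def)

lemma dy_dy_commute: "smooth_on T f \<Longrightarrow> p \<in> T \<Longrightarrow> dy i (dy j f) p = dy j (dy i f) p"
  unfolding dy_def by (rule dird_commute[OF open_T])

lemma dy_dx_commute: "smooth_on T f \<Longrightarrow> p \<in> T \<Longrightarrow> dy i (dx j f) p = dx j (dy i f) p"
  unfolding dy_def dx_def by (rule dird_commute[OF open_T])

lemma dy_diff:
  "smooth_on T f \<Longrightarrow> smooth_on T g \<Longrightarrow> p \<in> T \<Longrightarrow> dy i (\<lambda>q. f q - g q) p = dy i f p - dy i g p"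
  unfolding dy_def by (simp add: dird_diff)

lemma dy_contract:
  assumes "\<And>j. smooth_on T (f j)" "p \<in> T"
  shows "dy i (\<lambda>q. \<Sum>j\<in>UNIV. f j q * ycomp j q) p = (\<Sum>j\<in>UNIV. dy i (f j) p * ycomp j p) + f i p"
  unfolding dy_def using assms by (subst dird_contract) auto

lemma dx_contract:
  assumes "\<And>j. smooth_on T (f j)" "p \<in> T"
  shows "dx i (\<lambda>q. \<Sum>j\<in>UNIV. f j q * ycomp j q) p = (\<Sum>j\<in>UNIV. dx i (f j) p * ycomp j p)"
  unfolding dx_def using assms by (subst dird_contract) auto

text \<open>The last sum reflects that the horizontal derivative of y^j in direction i is -N^j_i.
  The metric function \<open>L'\<close> is a free variable in these rules, so that they serve both
  connections.\<close>

lemma hderiv_contract: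
  assumes "\<And>j. smooth_on T (f j)" "p \<in> T"
  shows "hderiv L' i (\<lambda>q. \<Sum>j\<in>UNIV. f j q * ycomp j q) p
    = (\<Sum>j\<in>UNIV. hderiv L' i (f j) p * ycomp j p) - (\<Sum>j\<in>UNIV. f j p * nonlin L' j i p)"
proof -
  have "smooth_on T (\<lambda>q. \<Sum>j\<in>UNIV. f j q * ycomp j q)"
    using assms by (intro smooth_intros)
  then show ?thesis
    using assms by (simp add: hderiv_dird dird_contract sum_negf)
qed

lemma hderiv_mult:
  assumes "smooth_on T f" "smooth_on T g" "p \<in> T"
  shows "hderiv L' i (\<lambda>q. f q * g q) p = f p * hderiv L' i g p + hderiv L' i f p * g p"
proof -
  have "smooth_on T (\<lambda>q. f q * g q)"
    using assms by (intro smooth_intros)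
  then show ?thesis
    using assms by (simp add: hderiv_dird dird_mult)
qed

lemma hderiv_add:
  assumes "smooth_on T f" "smooth_on T g" "p \<in> T"
  shows "hderiv L' i (\<lambda>q. f q + g q) p = hderiv L' i f p + hderiv L' i g p"
proof -
  have "smooth_on T (\<lambda>q. f q + g q)"
    using assms by (intro smooth_intros)
  then show ?thesis
    using assms by (simp add: hderiv_dird dird_add)
qed

text \<open>The function t -> L(x, t y) is differentiated at t = 1 in two ways: by the chain rule,
  and after replacing it by t L(x, y) near 1.\<close>

lemma euler_L:
  assumes "p \<in> T"
  shows "(\<Sum>i\<in>UNIV. L1 L i p * ycomp i p) = L p"
proof -
  obtain x y where p: "p = (x, y)" "x \<in> U" "y \<noteq> 0"
    using assms by (cases p) (auto simp: T_def)
  have "((\<lambda>t. (x, t *\<^sub>R y)) has_derivative (\<lambda>s. (0, s *\<^sub>R y))) (at 1)"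
    by (auto intro!: derivative_eq_intros)
  moreover have "(L has_derivative (\<lambda>v. dird v L p)) (at (x, 1 *\<^sub>R y))"
    using assms p by (simp add: has_derivative_dird)
  ultimately have "((\<lambda>t. L (x, t *\<^sub>R y)) has_derivative (\<lambda>s. dird (0, s *\<^sub>R y) L p)) (at 1)"
    using diff_chain_at[of "\<lambda>t. (x, t *\<^sub>R y)"] by (fastforce simp: o_def)
  moreover have "((\<lambda>t. L (x, t *\<^sub>R y)) has_derivative (\<lambda>s. s * L p)) (at 1)"
  proof (rule has_derivative_transform_within_open)
    show "((\<lambda>t. t * L p) has_derivative (\<lambda>s. s * L p)) (at 1)"
      by (auto intro!: derivative_eq_intros)
  qed (use p L_homogeneous in \<open>auto intro: open_greaterThan[of 0]\<close>)
  ultimately have "dird (0, 1 *\<^sub>R y) L p = 1 * L p"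
    using has_derivative_unique by metis
  then show ?thesis
    using assms p by (simp add: dird_pair L1_def ycomp_def mult.commute)
qed

lemma L2_sym: "p \<in> T \<Longrightarrow> L2 L i j p = L2 L j i p"
  unfolding L2_def L1_def by (rule dy_dy_commute) simp

lemma L3_sym12: "p \<in> T \<Longrightarrow> L3 L i j k p = L3 L j i k p"
  unfolding L3_def by (rule dy_cong) (auto simp: L2_sym)

lemma L3_sym23: "p \<in> T \<Longrightarrow> L3 L i j k p = L3 L i k j p"
  unfolding L3_def L2_def by (rule dy_dy_commute) simp

text \<open>The vertical derivative of Euler's relation: the term L_i from differentiating y cancels
  against the right side. One more derivative gives \<open>L3_y\<close>.\<close>

lemma L2_y:
  assumes "p \<in> T"
  shows "(\<Sum>j\<in>UNIV. L2 L i j p * ycomp j p) = 0"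
proof -
  have "L1 L i p = dy i (\<lambda>q. \<Sum>j\<in>UNIV. L1 L j q * ycomp j q) p"
    unfolding L1_def using assms by (intro dy_cong) (simp_all add: euler_L[unfolded L1_def])
  also have "\<dots> = (\<Sum>j\<in>UNIV. L2 L j i p * ycomp j p) + L1 L i p"
    using assms by (simp add: dy_contract L2_def)
  finally show ?thesis
    using L2_sym[OF assms, of i] by simp
qed

lemma L3_y:
  assumes "p \<in> T"
  shows "(\<Sum>k\<in>UNIV. L3 L i j k p * ycomp k p) = - L2 L i j p"
proof -
  have "0 = dy j (\<lambda>q. \<Sum>k\<in>UNIV. L2 L i k q * ycomp k q) p"
    using dy_cong[OF assms, of "\<lambda>q. \<Sum>k\<in>UNIV. L2 L i k q * ycomp k q" "\<lambda>q. 0" j]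
    by (simp add: L2_y dy_def)
  also have "\<dots> = (\<Sum>k\<in>UNIV. L3 L i k j p * ycomp k p) + L2 L i j p"
    using assms by (simp add: dy_contract L3_def)
  finally show ?thesis
    using L3_sym23[OF assms, of i j] by simp
qed

lemma dy_square: "p \<in> T \<Longrightarrow> dy j (\<lambda>q. (L q)\<^sup>2) p = 2 * (L p * L1 L j p)"
  unfolding dy_def L1_def power2_eq_square by (simp add: dird_mult)

text \<open>This splitting into a rank-one part and the angular part carries the whole argument:
  metricity of g breaks up into separate equations for L_i and L_ij.\<close>

lemma metric_eq:
  assumes "p \<in> T"
  shows "metric L i j p = L1 L i p * L1 L j p + L p * L2 L i j p"
proof -
  have "dy i (dy j (\<lambda>q. (L q)\<^sup>2)) p = dy i (\<lambda>q. 2 * (L q * L1 L j q)) p"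
    by (rule dy_cong[OF assms dy_square])
  also have "\<dots> = 2 * (L p * L2 L j i p + L1 L i p * L1 L j p)"
  proof -
    have "smooth_on T (\<lambda>q. L q * L1 L j q)" by (intro smooth_intros)
    then show ?thesis
      using assms by (simp add: dy_def L2_def L1_def[of L i] dird_cmult dird_mult)
  qed
  finally show ?thesis
    using L2_sym[OF assms, of i j] by (simp add: metric_def)
qed

lemma metric_sym: "p \<in> T \<Longrightarrow> metric L i j p = metric L j i p"
  by (simp add: metric_eq L2_sym mult.commute)

lemma metric_y:
  assumes "p \<in> T"
  shows "(\<Sum>j\<in>UNIV. metric L i j p * ycomp j p) = L p * L1 L i p"
proof -
  have "(\<Sum>j\<in>UNIV. metric L i j p * ycomp j p)
      = L1 L i p * (\<Sum>j\<in>UNIV. L1 L j p * ycomp j p) + L p * (\<Sum>j\<in>UNIV. L2 L i j p * ycomp j p)"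
    using assms by (simp add: metric_eq sum.distrib sum_distrib_left algebra_simps)
  then show ?thesis
    using assms by (simp add: euler_L L2_y)
qed

lemma dy_metric: "dy k (metric L i j) p = 2 * cartan_low L i j k p"
  by (simp add: cartan_low_def)

lemma cartan_low_eq:
  assumes "p \<in> T"
  shows "2 * cartan_low L i j k p = L1 L i p * L2 L j k p + L1 L j p * L2 L i k p
    + L1 L k p * L2 L i j p + L p * L3 L i j k p"
proof -
  have s: "smooth_on T (\<lambda>q. L1 L i q * L1 L j q)" "smooth_on T (\<lambda>q. L q * L2 L i j q)"
    by (intro smooth_intros)+
  have "dy k (metric L i j) p = dy k (\<lambda>q. L1 L i q * L1 L j q + L q * L2 L i j q) p"
    by (rule dy_cong[OF assms metric_eq])
  also have "\<dots> = L1 L i p * L2 L j k p + L2 L i k p * L1 L j p + (L p * L3 L i j k p + L1 L k p * L2 L i j p)"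
    using assms s by (simp add: dy_def L2_def[of L _ k] L3_def L1_def[of L k] dird_add dird_mult)
  finally show ?thesis
    by (simp add: dy_metric algebra_simps)
qed

lemma cartan_low_sym12: "p \<in> T \<Longrightarrow> cartan_low L i j k p = cartan_low L j i k p"
  using cartan_low_eq[of p i j k] cartan_low_eq[of p j i k] L3_sym12[of p i j k] L2_sym[of p i j]
  by simp

lemma cartan_low_sym23: "p \<in> T \<Longrightarrow> cartan_low L i j k p = cartan_low L i k j p"
  using cartan_low_eq[of p i j k] cartan_low_eq[of p i k j] L3_sym23[of p i j k] L2_sym[of p j k]
  by simp

text \<open>In \<open>cartan_low_eq\<close> two terms die by \<open>L2_y\<close>; Euler's relation
  turns the third into L L_ij, and \<open>L3_y\<close> turns the last into -L L_ij.\<close>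

lemma cartan_low_y:
  assumes "p \<in> T"
  shows "(\<Sum>k\<in>UNIV. cartan_low L i j k p * ycomp k p) = 0"
proof -
  have "(\<Sum>k\<in>UNIV. 2 * cartan_low L i j k p * ycomp k p)
      = L1 L i p * (\<Sum>k\<in>UNIV. L2 L j k p * ycomp k p) + L1 L j p * (\<Sum>k\<in>UNIV. L2 L i k p * ycomp k p)
        + L2 L i j p * (\<Sum>k\<in>UNIV. L1 L k p * ycomp k p) + L p * (\<Sum>k\<in>UNIV. L3 L i j k p * ycomp k p)"
    using assms by (simp add: cartan_low_eq sum.distrib sum_distrib_left algebra_simps)
  then have "2 * (\<Sum>k\<in>UNIV. cartan_low L i j k p * ycomp k p) = 0"
    using assms by (simp add: euler_L L2_y L3_y sum_distrib_left mult.assoc)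
  then show ?thesis by simp
qed

section \<open>The inverse metric; raising and lowering indices\<close>

lemma invertible_metric:
  assumes "p \<in> T"
  shows "invertible (\<chi> a b. metric L a b p)"
proof -
  let ?A = "\<chi> a b. metric L a b p"
  have "v = 0" if "?A *v v = 0" for v
  proof (rule ccontr)
    assume "v \<noteq> 0"
    obtain x y where "p = (x, y)" "x \<in> U" "y \<noteq> 0"
      using assms by (cases p) (auto simp: T_def)
    then have "0 < (\<Sum>i\<in>UNIV. \<Sum>j\<in>UNIV. metric L i j p * v $ i * v $ j)"
      using metric_pos \<open>v \<noteq> 0\<close> by simp
    also have "\<dots> = (\<Sum>i\<in>UNIV. v $ i * (?A *v v) $ i)"
      by (simp add: matrix_vector_mult_def sum_distrib_left mult_ac)
    finally show False using that by simp
  qed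
  then have "\<exists>B. B ** ?A = mat 1"
    by (simp only: matrix_left_invertible_ker) blast
  then show ?thesis
    using invertible_left_inverse by blast
qed

lemma metric_inv_left:
  assumes "p \<in> T"
  shows "(\<Sum>k\<in>UNIV. metric_inv L i k p * metric L k j p) = (if i = j then 1 else 0)"
proof -
  have "(matrix_inv (\<chi> a b. metric L a b p) ** (\<chi> a b. metric L a b p)) $ i $ j = mat 1 $ i $ j"
    by (simp add: matrix_inv_mult[OF invertible_metric[OF assms]])
  then show ?thesis
    by (simp add: matrix_matrix_mult_def metric_inv_def mat_def)
qed

lemma metric_inv_right:
  assumes "p \<in> T"
  shows "(\<Sum>k\<in>UNIV. metric L i k p * metric_inv L k j p) = (if i = j then 1 else 0)"
proof -
  have "((\<chi> a b. metric L a b p) ** matrix_inv (\<chi> a b. metric L a b p)) $ i $ j = mat 1 $ i $ j"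
    by (simp add: matrix_inv_mult[OF invertible_metric[OF assms]])
  then show ?thesis
    by (simp add: matrix_matrix_mult_def metric_inv_def mat_def)
qed

lemma raise_lower:
  assumes "p \<in> T"
  shows "(\<Sum>r\<in>UNIV. metric_inv L i r p * (\<Sum>s\<in>UNIV. metric L r s p * X s)) = X i"
proof -
  have "(\<Sum>r\<in>UNIV. metric_inv L i r p * (\<Sum>s\<in>UNIV. metric L r s p * X s))
      = (\<Sum>s\<in>UNIV. (\<Sum>r\<in>UNIV. metric_inv L i r p * metric L r s p) * X s)"
    unfolding sum_distrib_left sum_distrib_right by (subst sum.swap) (simp add: mult.assoc)
  also have "\<dots> = (\<Sum>s\<in>UNIV. if i = s then X s else 0)"
    using assms by (intro sum.cong) (auto simp: metric_inv_left)
  finally show ?thesis by simp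
qed

lemma lower_raise:
  assumes "p \<in> T"
  shows "(\<Sum>r\<in>UNIV. metric L i r p * (\<Sum>s\<in>UNIV. metric_inv L r s p * X s)) = X i"
proof -
  have "(\<Sum>r\<in>UNIV. metric L i r p * (\<Sum>s\<in>UNIV. metric_inv L r s p * X s))
      = (\<Sum>s\<in>UNIV. (\<Sum>r\<in>UNIV. metric L i r p * metric_inv L r s p) * X s)"
    unfolding sum_distrib_left sum_distrib_right by (subst sum.swap) (simp add: mult.assoc)
  also have "\<dots> = (\<Sum>s\<in>UNIV. if i = s then X s else 0)"
    using assms by (intro sum.cong) (auto simp: metric_inv_right)
  finally show ?thesis by simp
qed

text \<open>Identities for \<open>spray\<close>, \<open>nonlin\<close> and \<open>Gam\<close> are
  checked after lowering an index, where \<open>metric_inv\<close> has disappeared.\<close>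

lemma lower_inj:
  assumes "p \<in> T" "\<And>r. (\<Sum>s\<in>UNIV. metric L r s p * X s) = (\<Sum>s\<in>UNIV. metric L r s p * Y s)"
  shows "X i = Y i"
  using raise_lower[OF assms(1), of i X] raise_lower[OF assms(1), of i Y] assms(2) by simp

lemma metric_inv_sym:
  assumes "p \<in> T"
  shows "metric_inv L i j p = metric_inv L j i p"
proof -
  have "(\<Sum>s\<in>UNIV. metric L r s p * metric_inv L s j p) = (\<Sum>s\<in>UNIV. metric L r s p * metric_inv L j s p)"
    for r
    using metric_inv_left[OF assms, of j r] metric_sym[OF assms, of r]
    by (simp add: metric_inv_right[OF assms] mult.commute eq_commute)
  from lower_inj[OF assms this] show ?thesis .
qed

lemma smooth_metric_inv [smooth_intros, simp]: "smooth_on T (metric_inv L i j)"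
  unfolding metric_inv_def
  by (intro smooth_on_matrix_inv invertible_metric open_T) (simp_all add: smooth_intros)

lemma smooth_spray [smooth_intros, simp]: "smooth_on T (spray L i)"
  unfolding spray_def by (intro smooth_intros)

lemma smooth_nonlin [smooth_intros, simp]: "smooth_on T (nonlin L i j)"
  unfolding nonlin_def by (intro smooth_intros)

lemma smooth_hderiv [smooth_intros]: "smooth_on T f \<Longrightarrow> smooth_on T (hderiv L k f)"
  unfolding hderiv_def by (intro smooth_intros)

lemma smooth_Gam [smooth_intros, simp]: "smooth_on T (Gam L i j k)"
  unfolding Gam_def by (intro smooth_intros)

lemma Gam_sym:
  assumes "p \<in> T"
  shows "Gam L i j k p = Gam L i k j p"
proof -
  have "hderiv L r (metric L j k) p = hderiv L r (metric L k j) p" for r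
    using assms by (intro hderiv_cong metric_sym)
  then show ?thesis
    by (simp add: Gam_def add.commute)
qed

section \<open>Metricity of the connection; spray and nonlinear connection\<close>

lemma lower_Gam:
  assumes "p \<in> T"
  shows "2 * (\<Sum>s\<in>UNIV. metric L r s p * Gam L s j k p)
    = hderiv L j (metric L r k) p + hderiv L k (metric L r j) p - hderiv L r (metric L j k) p"
proof -
  have "2 * (\<Sum>s\<in>UNIV. metric L r s p * Gam L s j k p) = (\<Sum>s\<in>UNIV. metric L r s p *
      (\<Sum>t\<in>UNIV. metric_inv L s t p *
        (hderiv L j (metric L t k) p + hderiv L k (metric L t j) p - hderiv L t (metric L j k) p)))"
    by (simp add: Gam_def sum_distrib_left mult_ac)
  also have "\<dots> = hderiv L j (metric L r k) p + hderiv L k (metric L r j) p - hderiv L r (metric L j k) p"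
    by (rule lower_raise[OF assms])
  finally show ?thesis .
qed

text \<open>Two Christoffel expressions, with i and j exchanged, are added: four of the six
  derivatives cancel and the other two coincide.\<close>

lemma hderiv_metric:
  assumes "p \<in> T"
  shows "hderiv L k (metric L i j) p
    = (\<Sum>r\<in>UNIV. metric L r j p * Gam L r i k p) + (\<Sum>r\<in>UNIV. metric L i r p * Gam L r j k p)"
proof -
  have sym: "hderiv L r (metric L a b) p = hderiv L r (metric L b a) p" for r a b
    using assms by (intro hderiv_cong metric_sym)
  have "2 * (\<Sum>r\<in>UNIV. metric L r j p * Gam L r i k p) + 2 * (\<Sum>r\<in>UNIV. metric L i r p * Gam L r j k p)
      = 2 * hderiv L k (metric L i j) p"
    using lower_Gam[OF assms, of j i k] lower_Gam[OF assms, of i j k] sym[of _ i j] sym[of _ i k] sym[of _ j k]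
      metric_sym[OF assms, of _ j]
    by simp
  then show ?thesis by simp
qed

lemma dy_square_metric: "p \<in> T \<Longrightarrow> dy r (\<lambda>q. (L q)\<^sup>2) p = 2 * (\<Sum>s\<in>UNIV. metric L r s p * ycomp s p)"
  by (simp add: dy_square metric_y)

lemma dx_dy_square:
  assumes "p \<in> T"
  shows "dx j (dy r (\<lambda>q. (L q)\<^sup>2)) p = 2 * (\<Sum>s\<in>UNIV. dx j (metric L r s) p * ycomp s p)"
proof -
  have s: "smooth_on T (\<lambda>q. \<Sum>s\<in>UNIV. metric L r s q * ycomp s q)"
    by (intro smooth_intros)
  have "dx j (dy r (\<lambda>q. (L q)\<^sup>2)) p = dx j (\<lambda>q. 2 * (\<Sum>s\<in>UNIV. metric L r s q * ycomp s q)) p"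
    by (rule dx_cong[OF assms dy_square_metric])
  also have "\<dots> = 2 * dx j (\<lambda>q. \<Sum>s\<in>UNIV. metric L r s q * ycomp s q) p"
    unfolding dx_def using assms s by (intro dird_cmult) simp
  finally show ?thesis
    using assms by (simp add: dx_contract)
qed

lemma lower_spray:
  assumes "p \<in> T"
  shows "2 * (\<Sum>s\<in>UNIV. metric L r s p * spray L s p)
    = (\<Sum>k\<in>UNIV. dx k (dy r (\<lambda>q. (L q)\<^sup>2)) p * ycomp k p) - dx r (\<lambda>q. (L q)\<^sup>2) p"
proof -
  have "2 * (\<Sum>s\<in>UNIV. metric L r s p * spray L s p) = (\<Sum>s\<in>UNIV. metric L r s p *
      (\<Sum>t\<in>UNIV. metric_inv L s t p *
        ((\<Sum>k\<in>UNIV. ycomp k p * dx k (dy t (\<lambda>q. (L q)\<^sup>2)) p) - dx t (\<lambda>q. (L q)\<^sup>2) p)))"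
    by (simp add: spray_def sum_distrib_left mult_ac)
  also have "\<dots> = (\<Sum>k\<in>UNIV. ycomp k p * dx k (dy r (\<lambda>q. (L q)\<^sup>2)) p) - dx r (\<lambda>q. (L q)\<^sup>2) p"
    by (rule lower_raise[OF assms])
  finally show ?thesis by (simp add: mult.commute)
qed

text \<open>The vertical derivative of \<open>lower_spray\<close>. Differentiating g_rs on the left
  gives the Cartan tensor term; on the right, second vertical derivatives of L^2 become 2 g.\<close>

lemma lower_nonlin:
  assumes "p \<in> T"
  shows "2 * (\<Sum>s\<in>UNIV. metric L r s p * nonlin L s j p) + 2 * (\<Sum>s\<in>UNIV. cartan_low L r s j p * spray L s p)
    = (\<Sum>k\<in>UNIV. (dx j (metric L r k) p + dx k (metric L r j) p - dx r (metric L j k) p) * ycomp k p)"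
proof -
  let ?F = "\<lambda>q. (L q)\<^sup>2"
  let ?W = "\<lambda>q. \<Sum>k\<in>UNIV. dx k (dy r ?F) q * ycomp k q"
  have F: "smooth_on T ?F" by (intro smooth_intros)
  have sW: "smooth_on T ?W" "smooth_on T (dx r ?F)" by (intro smooth_intros F)+
  have sp: "smooth_on T (\<lambda>q. metric L r s q * spray L s q)"
    "smooth_on T (\<lambda>q. \<Sum>s\<in>UNIV. metric L r s q * spray L s q)" for s
    by (intro smooth_intros)+
  have mixed: "dy j (dx k (dy r ?F)) p = 2 * dx k (metric L r j) p" for k
  proof -
    have s: "smooth_on T (dy j (dy r ?F))" by (intro smooth_intros F)
    have "dy j (dx k (dy r ?F)) p = dx k (dy j (dy r ?F)) p"
      using assms F by (intro dy_dx_commute smooth_intros)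
    also have "\<dots> = dx k (\<lambda>q. 2 * metric L r j q) p"
    proof (rule dx_cong[OF assms])
      show "dy j (dy r ?F) q = 2 * metric L r j q" if "q \<in> T" for q
        using metric_sym[OF that, of r j] by (simp add: metric_def)
    qed
    also have "\<dots> = 2 * dx k (metric L r j) p"
      unfolding dx_def using assms by (intro dird_cmult) simp
    finally show ?thesis .
  qed
  have "2 * (\<Sum>s\<in>UNIV. metric L r s p * (2 * nonlin L s j p) + 2 * cartan_low L r s j p * spray L s p)
      = 2 * (\<Sum>s\<in>UNIV. metric L r s p * dy j (spray L s) p + dy j (metric L r s) p * spray L s p)"
    by (simp add: nonlin_def dy_metric)
  also have "\<dots> = 2 * (\<Sum>s\<in>UNIV. dy j (\<lambda>q. metric L r s q * spray L s q) p)"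
    unfolding dy_def using assms by (subst dird_mult) auto
  also have "\<dots> = dy j (\<lambda>q. 2 * (\<Sum>s\<in>UNIV. metric L r s q * spray L s q)) p"
    unfolding dy_def using assms sp by (simp add: dird_cmult dird_sum)
  also have "\<dots> = dy j (\<lambda>q. ?W q - dx r ?F q) p"
    by (rule dy_cong[OF assms lower_spray])
  also have "\<dots> = dy j ?W p - dy j (dx r ?F) p"
    by (rule dy_diff[OF sW assms])
  also have "dy j ?W p = (\<Sum>k\<in>UNIV. dy j (dx k (dy r ?F)) p * ycomp k p) + dx j (dy r ?F) p"
    using assms F by (intro dy_contract smooth_intros)
  also have "dy j (dx r ?F) p = dx r (dy j ?F) p"
    using assms F by (rule dy_dx_commute[rotated])
  finally have "2 * (2 * (\<Sum>s\<in>UNIV. metric L r s p * nonlin L s j p)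
        + 2 * (\<Sum>s\<in>UNIV. cartan_low L r s j p * spray L s p))
      = 2 * (\<Sum>k\<in>UNIV. (dx j (metric L r k) p + dx k (metric L r j) p - dx r (metric L j k) p) * ycomp k p)"
    by (simp add: mixed dx_dy_square[OF assms] sum.distrib sum_subtractf sum_distrib_left algebra_simps)
  then show ?thesis by simp
qed

lemma square_eq_contract:
  assumes "p \<in> T"
  shows "(L p)\<^sup>2 = (\<Sum>i\<in>UNIV. (\<Sum>j\<in>UNIV. metric L i j p * ycomp j p) * ycomp i p)"
proof -
  have "(\<Sum>i\<in>UNIV. (\<Sum>j\<in>UNIV. metric L i j p * ycomp j p) * ycomp i p)
      = L p * (\<Sum>i\<in>UNIV. L1 L i p * ycomp i p)"
    using assms by (simp add: metric_y sum_distrib_left mult.assoc)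
  then show ?thesis
    using assms by (simp add: euler_L power2_eq_square)
qed

text \<open>Euler's relation for the spray, which has degree 2 in y. It is obtained by contracting
  \<open>lower_nonlin\<close> with y: the Cartan term vanishes, two of the three sums coincide, and
  \<open>lower_spray\<close> reappears.\<close>

lemma nonlin_y:
  assumes "p \<in> T"
  shows "(\<Sum>j\<in>UNIV. nonlin L i j p * ycomp j p) = spray L i p"
proof (rule lower_inj[OF assms, of "\<lambda>i. \<Sum>j\<in>UNIV. nonlin L i j p * ycomp j p" "\<lambda>i. spray L i p"])
  fix r
  let ?y = "\<lambda>k. ycomp k p"
  have s: "smooth_on T (\<lambda>q. \<Sum>j\<in>UNIV. metric L i j q * ycomp j q)" for i
    by (intro smooth_intros)
  have sq: "dx r (\<lambda>q. (L q)\<^sup>2) p = (\<Sum>j\<in>UNIV. (\<Sum>k\<in>UNIV. dx r (metric L j k) p * ?y k) * ?y j)"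
    using dx_cong[OF assms square_eq_contract, where i = r] s assms by (simp add: dx_contract)
  have "(\<Sum>j\<in>UNIV. (\<Sum>s\<in>UNIV. cartan_low L r s j p * spray L s p) * ?y j)
      = (\<Sum>s\<in>UNIV. (\<Sum>j\<in>UNIV. cartan_low L r s j p * ?y j) * spray L s p)"
    unfolding sum_distrib_right by (subst sum.swap) (simp add: mult_ac)
  then have C: "(\<Sum>j\<in>UNIV. (\<Sum>s\<in>UNIV. cartan_low L r s j p * spray L s p) * ?y j) = 0"
    using assms by (simp add: cartan_low_y)
  have "2 * (\<Sum>s\<in>UNIV. metric L r s p * (\<Sum>j\<in>UNIV. nonlin L s j p * ?y j))
      = (\<Sum>j\<in>UNIV. (2 * (\<Sum>s\<in>UNIV. metric L r s p * nonlin L s j p)) * ?y j)"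
    unfolding sum_distrib_right sum_distrib_left by (subst sum.swap) (simp add: mult_ac)
  also have "\<dots> = (\<Sum>j\<in>UNIV. (2 * (\<Sum>s\<in>UNIV. metric L r s p * nonlin L s j p)
      + 2 * (\<Sum>s\<in>UNIV. cartan_low L r s j p * spray L s p)) * ?y j)"
    using C by (simp add: distrib_right sum.distrib mult.assoc flip: sum_distrib_left)
  also have "\<dots> = (\<Sum>j\<in>UNIV. (\<Sum>k\<in>UNIV. dx j (metric L r k) p * ?y k) * ?y j)
      + (\<Sum>j\<in>UNIV. (\<Sum>k\<in>UNIV. dx k (metric L r j) p * ?y k) * ?y j)
      - (\<Sum>j\<in>UNIV. (\<Sum>k\<in>UNIV. dx r (metric L j k) p * ?y k) * ?y j)"
    unfolding lower_nonlin[OF assms]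
    by (simp add: distrib_right left_diff_distrib sum.distrib sum_subtractf)
  also have "(\<Sum>j\<in>UNIV. (\<Sum>k\<in>UNIV. dx k (metric L r j) p * ?y k) * ?y j)
      = (\<Sum>j\<in>UNIV. (\<Sum>k\<in>UNIV. dx j (metric L r k) p * ?y k) * ?y j)"
    unfolding sum_distrib_right by (subst sum.swap) (simp add: mult_ac)
  also have "(\<Sum>j\<in>UNIV. (\<Sum>k\<in>UNIV. dx j (metric L r k) p * ?y k) * ?y j)
      + (\<Sum>j\<in>UNIV. (\<Sum>k\<in>UNIV. dx j (metric L r k) p * ?y k) * ?y j)
      - (\<Sum>j\<in>UNIV. (\<Sum>k\<in>UNIV. dx r (metric L j k) p * ?y k) * ?y j)
      = 2 * (\<Sum>s\<in>UNIV. metric L r s p * spray L s p)"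
    unfolding lower_spray[OF assms] dx_dy_square[OF assms] sq
    by (simp add: sum_distrib_left sum_distrib_right mult.assoc)
  finally show "(\<Sum>s\<in>UNIV. metric L r s p * (\<Sum>j\<in>UNIV. nonlin L s j p * ?y j))
      = (\<Sum>s\<in>UNIV. metric L r s p * spray L s p)"
    by simp
qed

lemma Gam_y:
  assumes "p \<in> T"
  shows "(\<Sum>k\<in>UNIV. Gam L i j k p * ycomp k p) = nonlin L i j p"
proof (rule lower_inj[OF assms, of "\<lambda>i. \<Sum>k\<in>UNIV. Gam L i j k p * ycomp k p" "\<lambda>i. nonlin L i j p"])
  fix r
  let ?y = "\<lambda>k. ycomp k p"
  have C: "(\<Sum>k\<in>UNIV. (\<Sum>s\<in>UNIV. nonlin L s a p * cartan_low L b k s p) * ?y k) = 0" for a b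
  proof -
    have "(\<Sum>k\<in>UNIV. (\<Sum>s\<in>UNIV. nonlin L s a p * cartan_low L b k s p) * ?y k)
        = (\<Sum>s\<in>UNIV. nonlin L s a p * (\<Sum>k\<in>UNIV. cartan_low L b s k p * ?y k))"
      unfolding sum_distrib_right sum_distrib_left
      by (subst sum.swap) (simp add: mult.assoc cartan_low_sym23[OF assms])
    then show ?thesis
      using assms by (simp add: cartan_low_y)
  qed
  \<comment> \<open>The vertical correction inside \<open>hderiv\<close> is a Cartan tensor
    contracted with y, hence zero.\<close>
  have h1: "(\<Sum>k\<in>UNIV. hderiv L a (metric L b k) p * ?y k) = (\<Sum>k\<in>UNIV. dx a (metric L b k) p * ?y k)" for a b
    using C[of a b]
    by (simp add: hderiv_def dy_metric left_diff_distrib sum_subtractf mult.left_commute[of _ 2] mult.assoc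
        flip: sum_distrib_left)
  have "(\<Sum>k\<in>UNIV. (\<Sum>s\<in>UNIV. nonlin L s k p * cartan_low L r j s p) * ?y k)
      = (\<Sum>s\<in>UNIV. (\<Sum>k\<in>UNIV. nonlin L s k p * ?y k) * cartan_low L r s j p)"
    unfolding sum_distrib_right 
    by (subst sum.swap) (simp add: mult_ac cartan_low_sym23[OF assms, of r j])
  \<comment> \<open>Here y meets the direction of differentiation instead, so N^s_k y^k = S^s
    survives. It supplies exactly the Cartan term of \<open>lower_nonlin\<close>.\<close>
  then have h2: "(\<Sum>k\<in>UNIV. hderiv L k (metric L r j) p * ?y k) = (\<Sum>k\<in>UNIV. dx k (metric L r j) p * ?y k)
      - 2 * (\<Sum>s\<in>UNIV. cartan_low L r s j p * spray L s p)"
    by (simp add: nonlin_y[OF assms] hderiv_def dy_metric left_diff_distrib sum_subtractf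
        mult.left_commute[of _ 2] mult.assoc mult.commute[of "spray _ _ _"] flip: sum_distrib_left)
  have "2 * (\<Sum>s\<in>UNIV. metric L r s p * (\<Sum>k\<in>UNIV. Gam L s j k p * ?y k))
      = (\<Sum>k\<in>UNIV. (2 * (\<Sum>s\<in>UNIV. metric L r s p * Gam L s j k p)) * ?y k)"
    unfolding sum_distrib_right sum_distrib_left by (subst sum.swap) (simp add: mult_ac)
  also have "\<dots> = (\<Sum>k\<in>UNIV. hderiv L j (metric L r k) p * ?y k)
      + (\<Sum>k\<in>UNIV. hderiv L k (metric L r j) p * ?y k) - (\<Sum>k\<in>UNIV. hderiv L r (metric L j k) p * ?y k)"
    unfolding lower_Gam[OF assms]
    by (simp add: distrib_right left_diff_distrib sum.distrib sum_subtractf)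
  also have "\<dots> = 2 * (\<Sum>s\<in>UNIV. metric L r s p * nonlin L s j p)"
    using lower_nonlin[OF assms, of r j]
    by (simp add: h1 h2 distrib_right left_diff_distrib sum.distrib sum_subtractf)
  finally show "(\<Sum>s\<in>UNIV. metric L r s p * (\<Sum>k\<in>UNIV. Gam L s j k p * ?y k))
      = (\<Sum>s\<in>UNIV. metric L r s p * nonlin L s j p)"
    by simp
qed

section \<open>First-order form of metricity: horizontal derivatives of L, L_i and L_ij\<close>

lemma hderiv_lower_y:
  assumes "p \<in> T"
  shows "hderiv L k (\<lambda>q. L q * L1 L i q) p = (\<Sum>r\<in>UNIV. L p * L1 L r p * Gam L r i k p)"
proof -
  let ?y = "\<lambda>k. ycomp k p"
  have "hderiv L k (\<lambda>q. L q * L1 L i q) p = hderiv L k (\<lambda>q. \<Sum>j\<in>UNIV. metric L i j q * ycomp j q) p"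
    by (rule hderiv_cong[OF assms]) (simp add: metric_y)
  also have "\<dots> = (\<Sum>j\<in>UNIV. hderiv L k (metric L i j) p * ?y j) - (\<Sum>j\<in>UNIV. metric L i j p * nonlin L j k p)"
    using assms by (simp add: hderiv_contract)
  \<comment> \<open>Metricity produces two sums. By \<open>Gam_y\<close> the second equals g_ir
    N^r_k and cancels the term that came from differentiating y.\<close>
  also have "(\<Sum>j\<in>UNIV. hderiv L k (metric L i j) p * ?y j)
      = (\<Sum>r\<in>UNIV. (\<Sum>j\<in>UNIV. metric L r j p * ?y j) * Gam L r i k p)
        + (\<Sum>r\<in>UNIV. metric L i r p * (\<Sum>j\<in>UNIV. Gam L r k j p * ?y j))"
  proof -
    have "(\<Sum>j\<in>UNIV. (\<Sum>r\<in>UNIV. metric L r j p * Gam L r i k p) * ?y j)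
        = (\<Sum>r\<in>UNIV. (\<Sum>j\<in>UNIV. metric L r j p * ?y j) * Gam L r i k p)"
      unfolding sum_distrib_right by (subst sum.swap) (simp add: mult_ac)
    moreover have "(\<Sum>j\<in>UNIV. (\<Sum>r\<in>UNIV. metric L i r p * Gam L r j k p) * ?y j)
        = (\<Sum>r\<in>UNIV. metric L i r p * (\<Sum>j\<in>UNIV. Gam L r k j p * ?y j))"
      unfolding sum_distrib_right sum_distrib_left
      by (subst sum.swap) (simp add: mult_ac Gam_sym[OF assms, of _ _ k])
    ultimately show ?thesis
      by (simp add: hderiv_metric[OF assms] distrib_right sum.distrib)
  qed
  finally show ?thesis
    by (simp add: Gam_y[OF assms] metric_y[OF assms])
qed

text \<open>L^2 is the contraction of L L_i with y, so \<open>hderiv_lower_y\<close> applies, and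
  the connection term cancels the derivative of y by the same mechanism.\<close>

lemma hderiv_L:
  assumes "p \<in> T"
  shows "hderiv L k L p = 0"
proof -
  let ?y = "\<lambda>k. ycomp k p"
  have s: "smooth_on T (\<lambda>q. L q * L1 L i q)" for i by (intro smooth_intros)
  have "2 * L p * hderiv L k L p = hderiv L k (\<lambda>q. L q * L q) p"
    using assms by (simp add: hderiv_mult)
  also have "\<dots> = hderiv L k (\<lambda>q. \<Sum>i\<in>UNIV. (L q * L1 L i q) * ycomp i q) p"
    by (rule hderiv_cong[OF assms]) (simp add: euler_L mult.assoc flip: sum_distrib_left)
  also have "\<dots> = (\<Sum>i\<in>UNIV. (\<Sum>r\<in>UNIV. L p * L1 L r p * Gam L r i k p) * ?y i)
      - (\<Sum>i\<in>UNIV. L p * L1 L i p * nonlin L i k p)"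
    using assms s by (simp add: hderiv_contract hderiv_lower_y)
  also have "(\<Sum>i\<in>UNIV. (\<Sum>r\<in>UNIV. L p * L1 L r p * Gam L r i k p) * ?y i)
      = (\<Sum>r\<in>UNIV. L p * L1 L r p * (\<Sum>i\<in>UNIV. Gam L r k i p * ?y i))"
    unfolding sum_distrib_right sum_distrib_left
    by (subst sum.swap) (simp add: mult_ac Gam_sym[OF assms, of _ _ k])
  finally show ?thesis
    using L_pos[OF assms] by (simp add: Gam_y[OF assms])
qed

lemma hderiv_L1:
  assumes "p \<in> T"
  shows "hderiv L k (L1 L i) p = (\<Sum>r\<in>UNIV. L1 L r p * Gam L r i k p)"
proof -
  have "L p * hderiv L k (L1 L i) p = L p * (\<Sum>r\<in>UNIV. L1 L r p * Gam L r i k p)"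
    using hderiv_lower_y[OF assms, of k i] assms
    by (simp add: hderiv_mult hderiv_L sum_distrib_left mult.assoc)
  then show ?thesis
    using L_pos[OF assms] by simp
qed

text \<open>The part of metricity that remains once L_i L_j is removed by \<open>hderiv_L1\<close>;
  the factor L passes through the derivative by \<open>hderiv_L\<close> and is divided out.\<close>

lemma hderiv_L2:
  assumes "p \<in> T"
  shows "hderiv L k (L2 L i j) p
    = (\<Sum>r\<in>UNIV. L2 L r j p * Gam L r i k p) + (\<Sum>r\<in>UNIV. L2 L i r p * Gam L r j k p)"
proof -
  have s: "smooth_on T (\<lambda>q. L1 L i q * L1 L j q)" "smooth_on T (\<lambda>q. L q * L2 L i j q)"
    by (intro smooth_intros)+
  have "hderiv L k (metric L i j) p = hderiv L k (\<lambda>q. L1 L i q * L1 L j q + L q * L2 L i j q) p"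
    by (rule hderiv_cong[OF assms metric_eq])
  also have "\<dots> = L1 L i p * hderiv L k (L1 L j) p + hderiv L k (L1 L i) p * L1 L j p
      + L p * hderiv L k (L2 L i j) p"
    using assms s by (simp add: hderiv_add hderiv_mult hderiv_L)
  finally have "L p * hderiv L k (L2 L i j) p
      = L p * ((\<Sum>r\<in>UNIV. L2 L r j p * Gam L r i k p) + (\<Sum>r\<in>UNIV. L2 L i r p * Gam L r j k p))"
    by (simp add: hderiv_metric[OF assms] metric_eq[OF assms] hderiv_L1[OF assms] distrib_right
        sum.distrib sum_distrib_left sum_distrib_right distrib_left mult_ac)
  then show ?thesis
    using L_pos[OF assms] by simp
qed

end

section \<open>The two Cartan connections\<close>

lemma dird_compose_fst:
  fixes f :: "real ^ 'n::finite \<Rightarrow> real"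
  assumes "f differentiable (at (fst p))"
  shows "dird v (\<lambda>q. f (fst q)) (p :: 'n tpoint) = dird (fst v) f (fst p)"
  using diff_chain_at[OF has_derivative_fst[OF has_derivative_ident] has_derivative_dird[OF assms]]
  by (intro dird_eq) (simp add: o_def)

lemmas sum_expand = distrib_left distrib_right left_diff_distrib right_diff_distrib
  add_divide_distrib diff_divide_distrib sum.distrib sum_subtractf
  sum_distrib_left sum_distrib_right sum_divide_distrib mult_ac

text \<open>\<open>T\<close> depends on \<open>U\<close> alone, so both instances of
  \<open>finsler_domain\<close> share it and one hypothesis \<open>p \<in> T\<close> serves the
  barred and the unbarred lemmas.\<close>

locale beta_change = finsler_domain U L + bar: finsler_domain U "Lbar L \<sigma> b"
  for U :: "(real ^ 'n::finite) set" and L \<sigma> b +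
  assumes smooth_sigma: "smooth_on U \<sigma>" and smooth_b: "smooth_on U b"
begin

abbreviation K where "K \<equiv> Lbar L \<sigma> b"
abbreviation D where "D \<equiv> Diff L \<sigma> b"
abbreviation D0 where "D0 \<equiv> Diff0 L \<sigma> b"
abbreviation D00 where "D00 \<equiv> Diff00 L \<sigma> b"

lemma fst_T: "p \<in> T \<Longrightarrow> fst p \<in> U" "fst ` T \<subseteq> U"
  by (auto simp: T_def)

lemma smooth_sigma_fst [smooth_intros, simp]: "smooth_on T (\<lambda>p. \<sigma> (fst p))"
  by (rule smooth_on_compose_fst[OF open_T fst_T(2) smooth_sigma])

lemma smooth_b_component: "smooth_on U (\<lambda>x. b x $ i)"
  by (rule smooth_on_bounded_linear[OF open_base bounded_linear_vec_nth smooth_b])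

lemma smooth_blow [smooth_intros, simp]: "smooth_on T (blow b i)"
  unfolding blow_def by (rule smooth_on_compose_fst[OF open_T fst_T(2) smooth_b_component])

lemma smooth_esig [smooth_intros, simp]: "smooth_on T (esig \<sigma>)"
  unfolding esig_def by (intro smooth_intros)

lemma smooth_Diff [smooth_intros, simp]: "smooth_on T (D i j k)"
  unfolding Diff_def by (intro smooth_intros bar.smooth_Gam)

lemma smooth_Diff0 [smooth_intros, simp]: "smooth_on T (D0 i j)"
  unfolding Diff0_def by (intro smooth_intros)

lemma esig_pos: "esig \<sigma> p > 0"
  by (simp add: esig_def)

lemma dy_blow [simp]: "p \<in> T \<Longrightarrow> dy j (blow b i) p = 0"
proof -
  assume "p \<in> T"
  then have "(\<lambda>x. b x $ i) differentiable (at (fst p))"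
    using smooth_on_differentiable[OF smooth_b_component fst_T(1)] by blast
  from dird_compose_fst[OF this] linear_frechet_derivative[OF this] show ?thesis
    by (simp add: dy_def blow_def[abs_def] linear_0)
qed

lemma dird_esig:
  assumes "p \<in> T"
  shows "dird v (esig \<sigma>) p = esig \<sigma> p * dird v (\<lambda>q. \<sigma> (fst q)) p"
proof -
  have "((\<lambda>q. \<sigma> (fst q)) has_derivative (\<lambda>v. dird v (\<lambda>q. \<sigma> (fst q)) p)) (at p)"
    using assms by (intro has_derivative_dird) simp
  then have "((\<lambda>q. exp (\<sigma> (fst q))) has_derivative (\<lambda>v. exp (\<sigma> (fst p)) * dird v (\<lambda>q. \<sigma> (fst q)) p)) (at p)"
    by (auto intro!: derivative_eq_intros)
  from dird_eq[OF this] show ?thesis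
    by (simp add: esig_def[abs_def])
qed

lemma dy_esig [simp]:
  assumes "p \<in> T"
  shows "dy i (esig \<sigma>) p = 0"
proof -
  have "\<sigma> differentiable (at (fst p))"
    using smooth_on_differentiable[OF smooth_sigma fst_T(1)[OF assms]] .
  from dird_compose_fst[OF this] linear_frechet_derivative[OF this] show ?thesis
    using assms by (simp add: dy_def dird_esig linear_0)
qed

lemma dx_esig: "p \<in> T \<Longrightarrow> dx i (esig \<sigma>) p = esig \<sigma> p * siglow \<sigma> i p"
  by (simp add: dx_def siglow_def dird_esig)

lemma hderiv_esig: "p \<in> T \<Longrightarrow> hderiv M i (esig \<sigma>) p = esig \<sigma> p * siglow \<sigma> i p"
  by (simp add: hderiv_def dx_esig)

lemma Lbar_pos: "p \<in> T \<Longrightarrow> K p > 0"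
  using bar.L_pos .

section \<open>Vertical derivatives of the changed metric function\<close>

lemma L1_bar:
  assumes "p \<in> T"
  shows "L1 K i p = esig \<sigma> p * L1 L i p + blow b i p"
proof -
  have s: "smooth_on T (\<lambda>q. \<Sum>j\<in>UNIV. blow b j q * ycomp j q)" "smooth_on T (\<lambda>q. esig \<sigma> q * L q)"
    by (intro smooth_intros)+
  have "L1 K i p = dird (0, axis i 1) (\<lambda>q. esig \<sigma> q * L q + (\<Sum>j\<in>UNIV. blow b j q * ycomp j q)) p"
    by (simp add: L1_def dy_def Lbar_def[abs_def] beta_def[abs_def])
  also have "\<dots> = dy i (\<lambda>q. esig \<sigma> q * L q) p + dy i (\<lambda>q. \<Sum>j\<in>UNIV. blow b j q * ycomp j q) p"
    unfolding dy_def using assms s by (intro dird_add) auto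
  also have "dy i (\<lambda>q. \<Sum>j\<in>UNIV. blow b j q * ycomp j q) p = blow b i p"
    using assms by (simp add: dy_contract)
  also have "dy i (\<lambda>q. esig \<sigma> q * L q) p = esig \<sigma> p * dy i L p + dy i (esig \<sigma>) p * L p"
    unfolding dy_def using assms by (intro dird_mult) auto
  finally show ?thesis
    using assms by (simp add: L1_def)
qed

lemma L2_bar:
  assumes "p \<in> T"
  shows "L2 K i j p = esig \<sigma> p * L2 L i j p"
proof -
  have s: "smooth_on T (\<lambda>q. esig \<sigma> q * L1 L i q)" by (intro smooth_intros)
  have "L2 K i j p = dy j (\<lambda>q. esig \<sigma> q * L1 L i q + blow b i q) p"
    unfolding L2_def by (rule dy_cong[OF assms L1_bar])
  also have "\<dots> = dy j (\<lambda>q. esig \<sigma> q * L1 L i q) p + dy j (blow b i) p"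
    unfolding dy_def using assms s by (intro dird_add) auto
  also have "dy j (\<lambda>q. esig \<sigma> q * L1 L i q) p = esig \<sigma> p * dy j (L1 L i) p + dy j (esig \<sigma>) p * L1 L i p"
    unfolding dy_def using assms by (intro dird_mult) auto
  finally show ?thesis
    using assms by (simp add: L2_def)
qed

lemma L3_bar:
  assumes "p \<in> T"
  shows "L3 K i j k p = esig \<sigma> p * L3 L i j k p"
proof -
  have "L3 K i j k p = dy k (\<lambda>q. esig \<sigma> q * L2 L i j q) p"
    unfolding L3_def by (rule dy_cong[OF assms L2_bar])
  also have "\<dots> = esig \<sigma> p * dy k (L2 L i j) p + dy k (esig \<sigma>) p * L2 L i j p"
    unfolding dy_def using assms by (intro dird_mult) auto
  finally show ?thesis
    using assms by (simp add: L3_def)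
qed

section \<open>Linear equations for the difference tensor\<close>

lemma Diff_sym: "p \<in> T \<Longrightarrow> D i j k p = D i k j p"
  by (simp add: Diff_def Gam_sym[of p i j k] bar.Gam_sym[of p i j k])

lemma Diff_y: "(\<Sum>j\<in>UNIV. D i j k p * ycomp j p) = D0 i k p"
  by (simp add: Diff0_def)

text \<open>The difference of \<open>Gam_y\<close> for the two metrics. \<open>Diff0\<close>
  contracts the first lower index and \<open>Gam_y\<close> the second, which is reconciled by the
  symmetry of \<open>Diff\<close>.\<close>

lemma nonlin_bar:
  assumes "p \<in> T"
  shows "nonlin K i j p = nonlin L i j p + D0 i j p"
proof -
  have "D0 i j p = (\<Sum>k\<in>UNIV. D i j k p * ycomp k p)"
    by (simp add: Diff0_def Diff_sym[OF assms, of _ _ j])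
  also have "\<dots> = nonlin K i j p - nonlin L i j p"
    using assms by (simp add: Diff_def left_diff_distrib sum_subtractf Gam_y bar.Gam_y)
  finally show ?thesis by simp
qed

lemma Diff0_y: "(\<Sum>k\<in>UNIV. D0 i k p * ycomp k p) = D00 i p"
  unfolding Diff0_def Diff00_def sum_distrib_right by (subst sum.swap) simp

lemma hderiv_bar:
  assumes "p \<in> T"
  shows "hderiv K k f p = hderiv L k f p - (\<Sum>r\<in>UNIV. dy r f p * D0 r k p)"
  using assms by (simp add: hderiv_def nonlin_bar distrib_right distrib_left sum.distrib mult.commute)

text \<open>\<open>hderiv_L2\<close> for both connections, compared. Differentiating the factor
  e^sigma leaves the sigma_k term, and exchanging the nonlinear connection inside the derivative
  leaves the L_ijr term.\<close>

lemma L2_Diff_symmetrized: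
  assumes "p \<in> T"
  shows "(\<Sum>r\<in>UNIV. L2 L j r p * D r i k p) + (\<Sum>r\<in>UNIV. L2 L i r p * D r j k p)
    = siglow \<sigma> k p * L2 L i j p - (\<Sum>r\<in>UNIV. L3 L i j r p * D0 r k p)"
proof -
  have "esig \<sigma> p * ((\<Sum>r\<in>UNIV. L2 L r j p * Gam K r i k p) + (\<Sum>r\<in>UNIV. L2 L i r p * Gam K r j k p))
      = hderiv K k (L2 K i j) p"
    using assms by (simp add: bar.hderiv_L2 L2_bar sum_distrib_left distrib_left mult.assoc)
  also have "\<dots> = hderiv K k (\<lambda>q. esig \<sigma> q * L2 L i j q) p"
    by (rule hderiv_cong[OF assms L2_bar])
  also have "\<dots> = esig \<sigma> p * hderiv K k (L2 L i j) p + hderiv K k (esig \<sigma>) p * L2 L i j p"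
    using assms by (simp add: hderiv_mult)
  also have "\<dots> = esig \<sigma> p * (hderiv L k (L2 L i j) p - (\<Sum>r\<in>UNIV. L3 L i j r p * D0 r k p)
      + siglow \<sigma> k p * L2 L i j p)"
    using assms by (simp add: hderiv_bar hderiv_esig L3_def algebra_simps)
  finally have "(\<Sum>r\<in>UNIV. L2 L r j p * Gam K r i k p) + (\<Sum>r\<in>UNIV. L2 L i r p * Gam K r j k p)
      = hderiv L k (L2 L i j) p - (\<Sum>r\<in>UNIV. L3 L i j r p * D0 r k p) + siglow \<sigma> k p * L2 L i j p"
    using esig_pos[of p] by simp
  then show ?thesis
    by (simp add: Diff_def hderiv_L2[OF assms] right_diff_distrib sum_subtractf L2_sym[OF assms, of _ j])
qed

lemma L1_bar_Diff:
  assumes "p \<in> T"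
  shows "(\<Sum>r\<in>UNIV. L1 K r p * D r i k p)
    = hcov_form L (blow b) i k p - esig \<sigma> p * ((\<Sum>r\<in>UNIV. L2 L i r p * D0 r k p) - siglow \<sigma> k p * L1 L i p)"
proof -
  have s: "smooth_on T (\<lambda>q. esig \<sigma> q * L1 L i q)" by (intro smooth_intros)
  have "(\<Sum>r\<in>UNIV. L1 K r p * Gam K r i k p) = hderiv K k (L1 K i) p"
    using assms by (simp add: bar.hderiv_L1)
  also have "\<dots> = hderiv K k (\<lambda>q. esig \<sigma> q * L1 L i q + blow b i q) p"
    by (rule hderiv_cong[OF assms L1_bar])
  also have "\<dots> = esig \<sigma> p * hderiv K k (L1 L i) p + hderiv K k (esig \<sigma>) p * L1 L i p
      + hderiv K k (blow b i) p"
    using assms s by (simp add: hderiv_add hderiv_mult)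
  also have "\<dots> = esig \<sigma> p * (\<Sum>r\<in>UNIV. L1 L r p * Gam L r i k p)
      - esig \<sigma> p * (\<Sum>r\<in>UNIV. L2 L i r p * D0 r k p)
      + esig \<sigma> p * siglow \<sigma> k p * L1 L i p + hderiv L k (blow b i) p"
    using assms by (simp add: hderiv_bar hderiv_esig hderiv_L1 L2_def algebra_simps)
  finally have "(\<Sum>r\<in>UNIV. L1 K r p * Gam K r i k p) = \<dots>" .
  \<comment> \<open>Contracting the unbarred connection with the barred L_r also yields b_r
    Gamma^r_ik, which completes the derivative of b_i to the covariant b_i|k.\<close>
  moreover have "(\<Sum>r\<in>UNIV. L1 K r p * Gam L r i k p)
      = esig \<sigma> p * (\<Sum>r\<in>UNIV. L1 L r p * Gam L r i k p) + (\<Sum>r\<in>UNIV. blow b r p * Gam L r i k p)"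
    using assms by (simp add: L1_bar distrib_right sum.distrib sum_distrib_left mult.assoc)
  ultimately show ?thesis
    by (simp add: Diff_def hcov_form_def right_diff_distrib sum_subtractf)
qed

text \<open>The Christoffel trick: a tensor symmetric in its last two indices is recovered from its
  symmetrization in the first two.\<close>

lemma L2_Diff:
  assumes "p \<in> T"
  shows "(\<Sum>r\<in>UNIV. L2 L i r p * D r j k p) = H3 L \<sigma> b i j k p"
proof -
  have s: "D r j i p = D r i j p" "D r k i p = D r i k p" "D r k j p = D r j k p" for r
    by (rule Diff_sym[OF assms])+
  have "L3 L k i r p = L3 L i k r p" "L3 L k j r p = L3 L j k r p" "L3 L j i r p = L3 L i j r p" for r
    by (rule L3_sym12[OF assms])+
  then show ?thesis
    using L2_Diff_symmetrized[OF assms, of j i k] L2_Diff_symmetrized[OF assms, of k i j]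
      L2_Diff_symmetrized[OF assms, of k j i] L2_sym[OF assms, of i j] L2_sym[OF assms, of i k]
      L2_sym[OF assms, of j k]
    by (simp add: H3_def s)
qed

text \<open>The left side is symmetric in i and k, so the right side may be averaged over both
  orders, and b_i|k becomes E_ik.\<close>

lemma L1_bar_Diff_sym:
  assumes "p \<in> T"
  shows "(\<Sum>r\<in>UNIV. L1 K r p * D r i k p) = H2 L \<sigma> b i k p"
proof -
  have "(\<Sum>r\<in>UNIV. L1 K r p * D r k i p) = (\<Sum>r\<in>UNIV. L1 K r p * D r i k p)"
    by (simp add: Diff_sym[OF assms, of _ k])
  then show ?thesis
    using L1_bar_Diff[OF assms, of i k] L1_bar_Diff[OF assms, of k i]
    by (simp add: H2_def Elow_def sigsym_def algebra_simps)
qed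

section \<open>Solution of the linear systems\<close>

lemma metric_inv_L1:
  assumes "p \<in> T"
  shows "(\<Sum>r\<in>UNIV. metric_inv L i r p * L1 L r p) = Lup L i p"
proof -
  have "L p * (\<Sum>r\<in>UNIV. metric_inv L i r p * L1 L r p) = ycomp i p"
    using raise_lower[OF assms, of i "\<lambda>i. ycomp i p"]
    unfolding metric_y[OF assms] by (simp add: sum_distrib_left mult_ac)
  then show ?thesis
    using L_pos[OF assms] by (simp add: Lup_def field_simps)
qed

lemma sum_metric_inv_swap:
  assumes "p \<in> T"
  shows "(\<Sum>r\<in>UNIV. X r * (\<Sum>s\<in>UNIV. metric_inv L r s p * Y s))
    = (\<Sum>s\<in>UNIV. (\<Sum>r\<in>UNIV. metric_inv L s r p * X r) * Y s)"
  unfolding sum_distrib_left sum_distrib_right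
  by (subst sum.swap) (simp add: metric_inv_sym[OF assms] mult_ac)

lemma beta_y: "(\<Sum>i\<in>UNIV. blow b i p * Lup L i p) = beta b p / L p"
  by (simp add: beta_def Lup_def sum_divide_distrib)

text \<open>\<open>L\<^sub>i\<^sub>r\<close> has kernel spanned by \<open>y\<close>, and the second equation fixes the component along \<open>y\<close>.\<close>

lemma solve_linear_system:
  assumes "p \<in> T"
    and Q: "\<And>i. (\<Sum>r\<in>UNIV. L2 L i r p * X r) = Q i"
    and k: "(\<Sum>r\<in>UNIV. L1 K r p * X r) = k"
  shows "X i = L p * (\<Sum>r\<in>UNIV. metric_inv L i r p * Q r)
    + L p / K p * (k - L p * (\<Sum>i\<in>UNIV. bup L b i p * Q i)) * Lup L i p"
proof -
  \<comment> \<open>The undetermined component of X: lowering X with g gives L_r u + L Q_r, so X is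
    known up to a multiple \<open>u\<close> of L^i.\<close>
  define u where "u = (\<Sum>r\<in>UNIV. L1 L r p * X r)"
  define B where "B = (\<Sum>i\<in>UNIV. bup L b i p * Q i)"
  have lower: "(\<Sum>s\<in>UNIV. metric L r s p * X s) = L1 L r p * u + L p * Q r" for r
    unfolding u_def Q[symmetric]
    by (simp add: metric_eq[OF assms(1)] distrib_right sum.distrib sum_distrib_left mult.assoc)
  have X: "X r = L p * (\<Sum>s\<in>UNIV. metric_inv L r s p * Q s) + u * Lup L r p" for r
  proof -
    have "X r = (\<Sum>s\<in>UNIV. metric_inv L r s p * (L1 L s p * u + L p * Q s))"
      using raise_lower[OF assms(1), of r X] by (simp add: lower)
    also have "\<dots> = (\<Sum>s\<in>UNIV. metric_inv L r s p * L1 L s p) * u + L p * (\<Sum>s\<in>UNIV. metric_inv L r s p * Q s)"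
      by (simp add: distrib_left sum.distrib sum_distrib_left sum_distrib_right mult_ac)
    finally show ?thesis
      by (simp add: metric_inv_L1[OF assms(1)])
  qed
  have "(\<Sum>r\<in>UNIV. blow b r p * X r)
      = L p * (\<Sum>r\<in>UNIV. blow b r p * (\<Sum>s\<in>UNIV. metric_inv L r s p * Q s))
        + u * (\<Sum>r\<in>UNIV. blow b r p * Lup L r p)"
    unfolding X by (simp add: distrib_left sum.distrib sum_distrib_left mult_ac)
  also have "(\<Sum>r\<in>UNIV. blow b r p * (\<Sum>s\<in>UNIV. metric_inv L r s p * Q s)) = B"
    unfolding sum_metric_inv_swap[OF assms(1)] B_def bup_def ..
  finally have "(\<Sum>r\<in>UNIV. blow b r p * X r) = L p * B + u * (beta b p / L p)"
    by (simp add: beta_y)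
  \<comment> \<open>Inserting X gives k = u (e^sigma + beta/L) + L B. The bracket is K/L, which is
    nonzero, so \<open>u\<close> is determined; this is the origin of the factor L/K in all three
    formulas.\<close>
  moreover have "k = esig \<sigma> p * u + (\<Sum>r\<in>UNIV. blow b r p * X r)"
    unfolding k[symmetric] u_def
    by (simp add: L1_bar[OF assms(1)] distrib_right sum.distrib sum_distrib_left mult.assoc)
  ultimately have "(k - L p * B) * L p = u * K p"
    using L_pos[OF assms(1)] by (simp add: Lbar_def field_simps)
  then have "u = L p / K p * (k - L p * B)"
    using Lbar_pos[OF assms(1)] by (simp add: field_simps)
  then show ?thesis
    unfolding X[of i] B_def by simp
qed

lemma Diff_formula: "p \<in> T \<Longrightarrow> D i j k p = Diff_expr L \<sigma> b i j k p"
  unfolding Diff_expr_def Hup_def Hbeta_def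
  by (rule solve_linear_system[OF _ L2_Diff L1_bar_Diff_sym])

section \<open>Contractions of the difference tensor with y\<close>

lemma contract_Diff: "(\<Sum>j\<in>UNIV. (\<Sum>r\<in>UNIV. f r * D r j k p) * ycomp j p) = (\<Sum>r\<in>UNIV. f r * D0 r k p)"
  unfolding Diff_y[symmetric] sum_distrib_left sum_distrib_right
  by (subst sum.swap) (simp add: mult.assoc)

lemma contract_Diff0: "(\<Sum>j\<in>UNIV. (\<Sum>r\<in>UNIV. f r * D0 r j p) * ycomp j p) = (\<Sum>r\<in>UNIV. f r * D00 r p)"
  unfolding Diff0_y[symmetric] sum_distrib_left sum_distrib_right
  by (subst sum.swap) (simp add: mult.assoc)

lemma contract_L2:
  assumes "p \<in> T"
  shows "(\<Sum>j\<in>UNIV. (\<Sum>r\<in>UNIV. L2 L j r p * f r) * ycomp j p) = 0"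
proof -
  have "(\<Sum>j\<in>UNIV. (\<Sum>r\<in>UNIV. L2 L j r p * f r) * ycomp j p)
      = (\<Sum>r\<in>UNIV. (\<Sum>j\<in>UNIV. L2 L r j p * ycomp j p) * f r)"
    unfolding sum_distrib_left sum_distrib_right
    by (subst sum.swap) (simp add: L2_sym[OF assms] mult_ac)
  then show ?thesis
    by (simp add: L2_y[OF assms])
qed

lemma contract_L3:
  assumes "p \<in> T"
  shows "(\<Sum>j\<in>UNIV. (\<Sum>r\<in>UNIV. L3 L i j r p * f r) * ycomp j p) = - (\<Sum>r\<in>UNIV. L2 L i r p * f r)"
proof -
  have "(\<Sum>j\<in>UNIV. (\<Sum>r\<in>UNIV. L3 L i j r p * f r) * ycomp j p)
      = (\<Sum>r\<in>UNIV. (\<Sum>j\<in>UNIV. L3 L i r j p * ycomp j p) * f r)"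
    unfolding sum_distrib_left sum_distrib_right
    by (subst sum.swap) (simp add: L3_sym23[OF assms, of i] mult_ac)
  then show ?thesis
    by (simp add: L3_y[OF assms] sum_negf)
qed

text \<open>Contracting the system for D^r_jk feeds L_ir D^r_0k back into the right side, so only
  its sum with the transpose is determined. The matching difference is taken from
  \<open>L1_bar_Diff\<close>; half of the total is the claim.\<close>

lemma L2_Diff0:
  assumes "p \<in> T"
  shows "(\<Sum>r\<in>UNIV. L2 L i r p * D0 r k p) = Glow L \<sigma> b i k p"
proof -
  have H: "2 * H3 L \<sigma> b i j k p = (\<Sum>r\<in>UNIV. L3 L j k r p * D0 r i p)
      - (\<Sum>r\<in>UNIV. L3 L i j r p * D0 r k p) - (\<Sum>r\<in>UNIV. L3 L i k r p * D0 r j p)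
      + siglow \<sigma> j p * L2 L i k p + siglow \<sigma> k p * L2 L i j p - siglow \<sigma> i p * L2 L j k p" for j
    by (simp add: H3_def)
  have "2 * (\<Sum>r\<in>UNIV. L2 L i r p * D0 r k p) = (\<Sum>j\<in>UNIV. (2 * H3 L \<sigma> b i j k p) * ycomp j p)"
    by (simp add: contract_Diff[symmetric] L2_Diff[OF assms] sum_distrib_left mult.assoc)
  also have "\<dots> = (\<Sum>j\<in>UNIV. (\<Sum>r\<in>UNIV. L3 L k j r p * D0 r i p) * ycomp j p)
      - (\<Sum>j\<in>UNIV. (\<Sum>r\<in>UNIV. L3 L i j r p * D0 r k p) * ycomp j p)
      - (\<Sum>j\<in>UNIV. (\<Sum>r\<in>UNIV. L3 L i k r p * D0 r j p) * ycomp j p)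
      + L2 L i k p * (\<Sum>j\<in>UNIV. siglow \<sigma> j p * ycomp j p)
      + siglow \<sigma> k p * (\<Sum>j\<in>UNIV. L2 L i j p * ycomp j p)
      - siglow \<sigma> i p * (\<Sum>j\<in>UNIV. L2 L k j p * ycomp j p)"
    unfolding H
    by (simp add: sum_expand L3_sym12[OF assms, of _ k] L2_sym[OF assms, of _ k])
  also have "\<dots> = (\<Sum>r\<in>UNIV. L2 L i r p * D0 r k p) - (\<Sum>r\<in>UNIV. L2 L k r p * D0 r i p)
      - (\<Sum>r\<in>UNIV. L3 L i k r p * D00 r p) + sig0 \<sigma> p * L2 L i k p"
    by (simp add: contract_L3[OF assms] contract_Diff0 L2_y[OF assms] sig0_def)
  finally have sym: "(\<Sum>r\<in>UNIV. L2 L i r p * D0 r k p) + (\<Sum>r\<in>UNIV. L2 L k r p * D0 r i p)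
      = sig0 \<sigma> p * L2 L i k p - (\<Sum>r\<in>UNIV. L3 L i k r p * D00 r p)"
    by simp
  \<comment> \<open>Start of the skew part: the left sides of \<open>L1_bar_Diff\<close> for (i,k)
    and (k,i) agree, so subtracting leaves F_ik and \<open>musk\<close>.\<close>
  have "(\<Sum>r\<in>UNIV. L1 K r p * D r k i p) = (\<Sum>r\<in>UNIV. L1 K r p * D r i k p)"
    by (simp add: Diff_sym[OF assms, of _ k])
  then have "esig \<sigma> p * ((\<Sum>r\<in>UNIV. L2 L i r p * D0 r k p) - (\<Sum>r\<in>UNIV. L2 L k r p * D0 r i p))
      = 2 * Flow L b i k p - esig \<sigma> p * musk L \<sigma> i k p"
    using L1_bar_Diff[OF assms, of i k] L1_bar_Diff[OF assms, of k i]
    by (simp add: Flow_def musk_def algebra_simps)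
  also have "\<dots> = esig \<sigma> p * (2 * exp (- \<sigma> (fst p)) * Flow L b i k p - musk L \<sigma> i k p)"
    by (simp add: esig_def exp_minus field_simps)
  finally have "(\<Sum>r\<in>UNIV. L2 L i r p * D0 r k p) - (\<Sum>r\<in>UNIV. L2 L k r p * D0 r i p)
      = 2 * exp (- \<sigma> (fst p)) * Flow L b i k p - musk L \<sigma> i k p"
    using esig_pos[of p] by simp
  with sym show ?thesis
    unfolding Glow_def by (simp add: field_simps)
qed

lemma L1_bar_Diff0:
  assumes "p \<in> T"
  shows "(\<Sum>r\<in>UNIV. L1 K r p * D0 r k p) = G1 L \<sigma> b k p"
proof -
  have "(\<Sum>r\<in>UNIV. L1 K r p * D0 r k p) = (\<Sum>j\<in>UNIV. H2 L \<sigma> b k j p * ycomp j p)"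
    by (simp add: contract_Diff[symmetric] L1_bar_Diff_sym[OF assms, symmetric] Diff_sym[OF assms, of _ k])
  also have "\<dots> = (\<Sum>j\<in>UNIV. Elow L b j k p * ycomp j p)
      - 1/2 * esig \<sigma> p * ((\<Sum>j\<in>UNIV. (\<Sum>r\<in>UNIV. L2 L k r p * D0 r j p) * ycomp j p)
        + (\<Sum>j\<in>UNIV. (\<Sum>r\<in>UNIV. L2 L j r p * D0 r k p) * ycomp j p)
        - (siglow \<sigma> k p * (\<Sum>j\<in>UNIV. L1 L j p * ycomp j p) + L1 L k p * (\<Sum>j\<in>UNIV. siglow \<sigma> j p * ycomp j p)))"
    by (simp add: H2_def sigsym_def Elow_def[of L b _ k] Elow_def[of L b k] add.commute[of "hcov_form _ _ k _ _"]
        distrib_right left_diff_distrib right_diff_distrib distrib_left sum.distrib sum_subtractf sum_distrib_left mult_ac)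
  also have "\<dots> = G1 L \<sigma> b k p"
    unfolding contract_Diff0 contract_L2[OF assms] euler_L[OF assms] G1_def E0_def sig0_def
    by (simp add: algebra_simps)
  finally show ?thesis .
qed

lemma Diff0_formula: "p \<in> T \<Longrightarrow> D0 i j p = Diff0_expr L \<sigma> b i j p"
  unfolding Diff0_expr_def Gup_def Gbeta_def
  by (rule solve_linear_system[OF _ L2_Diff0 L1_bar_Diff0])

text \<open>In the contracted \<open>Glow\<close> the L_ijr term becomes one half of the left side.
  Absorbing it doubles the rest, hence the factor 2 before F_i0.\<close>

lemma L2_Diff00:
  assumes "p \<in> T"
  shows "(\<Sum>r\<in>UNIV. L2 L i r p * D00 r p)
    = 2 * exp (- \<sigma> (fst p)) * F0 L b i p - L p * siglow \<sigma> i p + sig0 \<sigma> p * L1 L i p"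
proof -
  have "(\<Sum>r\<in>UNIV. L2 L i r p * D00 r p) = (\<Sum>j\<in>UNIV. Glow L \<sigma> b i j p * ycomp j p)"
    by (simp add: contract_Diff0[symmetric] L2_Diff0[OF assms])
  also have "\<dots> = exp (- \<sigma> (fst p)) * (\<Sum>j\<in>UNIV. Flow L b i j p * ycomp j p)
      - 1/2 * (\<Sum>j\<in>UNIV. (\<Sum>r\<in>UNIV. L3 L i j r p * D00 r p) * ycomp j p)
      + 1/2 * (sig0 \<sigma> p * (\<Sum>j\<in>UNIV. L2 L i j p * ycomp j p)
        - (siglow \<sigma> i p * (\<Sum>j\<in>UNIV. L1 L j p * ycomp j p) - L1 L i p * (\<Sum>j\<in>UNIV. siglow \<sigma> j p * ycomp j p)))"
    by (simp add: Glow_def musk_def distrib_right left_diff_distrib right_diff_distrib distrib_left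
        sum.distrib sum_subtractf sum_distrib_left mult_ac)
  finally show ?thesis
    unfolding contract_L3[OF assms] L2_y[OF assms] euler_L[OF assms] F0_def sig0_def
    by (simp add: algebra_simps)
qed

lemma L1_bar_Diff00:
  assumes "p \<in> T"
  shows "(\<Sum>r\<in>UNIV. L1 K r p * D00 r p) = E00 L b p + esig \<sigma> p * sig0 \<sigma> p * L p"
proof -
  have "(\<Sum>r\<in>UNIV. L1 K r p * D00 r p) = (\<Sum>j\<in>UNIV. G1 L \<sigma> b j p * ycomp j p)"
    by (simp add: contract_Diff0[symmetric] L1_bar_Diff0[OF assms])
  also have "\<dots> = (\<Sum>j\<in>UNIV. E0 L b j p * ycomp j p)
      - 1/2 * esig \<sigma> p * (\<Sum>j\<in>UNIV. (\<Sum>r\<in>UNIV. L2 L j r p * D00 r p) * ycomp j p)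
      + 1/2 * esig \<sigma> p * (sig0 \<sigma> p * (\<Sum>j\<in>UNIV. L1 L j p * ycomp j p)
        + L p * (\<Sum>j\<in>UNIV. siglow \<sigma> j p * ycomp j p))"
    by (simp add: G1_def distrib_right left_diff_distrib right_diff_distrib distrib_left
        sum.distrib sum_subtractf sum_distrib_left mult_ac)
  also have "(\<Sum>j\<in>UNIV. E0 L b j p * ycomp j p) = E00 L b p"
    unfolding E0_def E00_def sum_distrib_right by (subst sum.swap) simp
  finally show ?thesis
    by (simp add: contract_L2[OF assms] euler_L[OF assms] sig0_def)
qed

lemma bup_L1:
  assumes "p \<in> T"
  shows "(\<Sum>r\<in>UNIV. bup L b r p * L1 L r p) = beta b p / L p"
proof -
  have "(\<Sum>r\<in>UNIV. bup L b r p * L1 L r p) = (\<Sum>r\<in>UNIV. blow b r p * (\<Sum>s\<in>UNIV. metric_inv L r s p * L1 L s p))"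
    unfolding sum_metric_inv_swap[OF assms] bup_def ..
  then show ?thesis
    unfolding metric_inv_L1[OF assms] beta_y .
qed

lemma Diff00_formula:
  assumes "p \<in> T"
  shows "D00 i p = Diff00_expr L \<sigma> b i p"
proof -
  let ?e = "exp (- \<sigma> (fst p))"
  define Q where "Q i = 2 * ?e * F0 L b i p - L p * siglow \<sigma> i p + sig0 \<sigma> p * L1 L i p" for i
  have raise: "(\<Sum>r\<in>UNIV. metric_inv L i r p * Q r)
      = 2 * ?e * F0up L b i p - L p * sigup L \<sigma> i p + sig0 \<sigma> p * Lup L i p"
    unfolding metric_inv_L1[OF assms, symmetric] Q_def F0up_def sigup_def
    by (simp add: metric_inv_sym[OF assms, of i] distrib_left right_diff_distrib sum.distrib sum_subtractf
        sum_distrib_left mult_ac)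
  have "(\<Sum>r\<in>UNIV. bup L b r p * Q r)
      = 2 * ?e * Fbeta0 L b p - L p * sigbeta L \<sigma> b p + sig0 \<sigma> p * (beta b p / L p)"
    unfolding Q_def Fbeta0_def sigbeta_def bup_L1[OF assms, symmetric]
    by (simp add: sum_expand)
  then have "D00 i p = L p * (2 * ?e * F0up L b i p - L p * sigup L \<sigma> i p + sig0 \<sigma> p * Lup L i p)
      + L p / K p * (E00 L b p + esig \<sigma> p * sig0 \<sigma> p * L p
        - L p * (2 * ?e * Fbeta0 L b p - L p * sigbeta L \<sigma> b p + sig0 \<sigma> p * (beta b p / L p))) * Lup L i p"
    using solve_linear_system[OF assms, of "\<lambda>i. D00 i p" Q _ i, OF _ L1_bar_Diff00[OF assms]]
    by (simp add: Q_def[symmetric] L2_Diff00[OF assms] raise)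
  \<comment> \<open>The sigma_0 term from raising L_i is put over K = e^sigma L + beta. Its beta
    part cancels the beta term inside the bracket, and its e^sigma L part doubles the one already
    there.\<close>
  moreover have "L p * (sig0 \<sigma> p * Lup L i p) = L p / K p * (sig0 \<sigma> p * (esig \<sigma> p * L p + beta b p)) * Lup L i p"
    using Lbar_pos[OF assms] by (simp add: Lbar_def field_simps)
  ultimately show ?thesis
    using L_pos[OF assms]
    by (simp add: Diff00_expr_def algebra_simps power2_eq_square)
qed

section \<open>The torsion tensors\<close>

lemma mlow_y:
  assumes "p \<in> T"
  shows "(\<Sum>i\<in>UNIV. mlow L b i p * Lup L i p) = 0"
proof -
  have "(\<Sum>i\<in>UNIV. L1 L i p * Lup L i p) = 1"
    using euler_L[OF assms] L_pos[OF assms] by (simp add: Lup_def flip: sum_divide_distrib)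
  moreover have "(\<Sum>i\<in>UNIV. mlow L b i p * Lup L i p) = (\<Sum>i\<in>UNIV. blow b i p * Lup L i p)
      - beta b p / L p * (\<Sum>i\<in>UNIV. L1 L i p * Lup L i p)"
    by (simp add: mlow_def left_diff_distrib sum_subtractf sum_distrib_left mult.assoc)
  ultimately show ?thesis
    by (simp add: beta_y)
qed

text \<open>m_k is the angular part of b_k: in b_k = g_kr b^r the splitting \<open>metric_eq\<close>
  separates the component (beta/L) L_k.\<close>

lemma bup_L2:
  assumes "p \<in> T"
  shows "L p * (\<Sum>r\<in>UNIV. bup L b r p * L2 L r k p) = mlow L b k p"
proof -
  have "blow b k p = (\<Sum>r\<in>UNIV. metric L k r p * bup L b r p)"
    unfolding bup_def by (rule lower_raise[OF assms, symmetric])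
  also have "\<dots> = L1 L k p * (\<Sum>r\<in>UNIV. bup L b r p * L1 L r p) + L p * (\<Sum>r\<in>UNIV. bup L b r p * L2 L r k p)"
    by (simp add: metric_eq[OF assms] L2_sym[OF assms, of k] sum_expand)
  finally show ?thesis
    by (simp add: bup_L1[OF assms] mlow_def)
qed

text \<open>m^i and b^i differ by a multiple of L^i, which m_i annihilates.\<close>

lemma bup_mlow:
  assumes "p \<in> T"
  shows "(\<Sum>i\<in>UNIV. bup L b i p * mlow L b i p) = msq L b p"
proof -
  have mup: "mup L b i p = bup L b i p - beta b p / L p * Lup L i p" for i
    unfolding metric_inv_L1[OF assms, symmetric] mup_def bup_def mlow_def
    by (simp add: right_diff_distrib sum_subtractf sum_distrib_left mult_ac)
  have "msq L b p = (\<Sum>i\<in>UNIV. bup L b i p * mlow L b i p)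
      - beta b p / L p * (\<Sum>i\<in>UNIV. mlow L b i p * Lup L i p)"
    by (simp add: msq_def mup right_diff_distrib sum_subtractf sum_distrib_left mult_ac)
  then show ?thesis
    by (simp add: mlow_y[OF assms])
qed

text \<open>The barred L_r is, up to the factor K, the barred y with lowered index. It therefore
  lowers the upper index and contracts it with y, which gives zero by total symmetry.\<close>

lemma L1_bar_cartan_bar:
  assumes "p \<in> T"
  shows "(\<Sum>r\<in>UNIV. L1 K r p * cartan K r j k p) = 0"
proof -
  have "K p * (\<Sum>r\<in>UNIV. L1 K r p * cartan K r j k p)
      = (\<Sum>r\<in>UNIV. (\<Sum>i\<in>UNIV. metric K r i p * ycomp i p) * cartan K r j k p)"
    by (simp add: bar.metric_y[OF assms] sum_distrib_left mult.assoc)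
  also have "\<dots> = (\<Sum>i\<in>UNIV. (\<Sum>r\<in>UNIV. metric K i r p * cartan K r j k p) * ycomp i p)"
    unfolding sum_distrib_right by (subst sum.swap) (simp add: bar.metric_sym[OF assms] mult_ac)
  also have "\<dots> = (\<Sum>i\<in>UNIV. cartan_low K k j i p * ycomp i p)"
  proof (rule sum.cong[OF refl])
    fix i
    have "(\<Sum>r\<in>UNIV. metric K i r p * cartan K r j k p) = cartan_low K i j k p"
      unfolding cartan_def by (rule bar.lower_raise[OF assms])
    also have "\<dots> = cartan_low K k j i p"
      using bar.cartan_low_sym12[OF assms, of i j k] bar.cartan_low_sym23[OF assms, of j i k]
        bar.cartan_low_sym12[OF assms, of j k i] by simp
    finally show "(\<Sum>r\<in>UNIV. metric K i r p * cartan K r j k p) * ycomp i p = cartan_low K k j i p * ycomp i p"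
      by simp
  qed
  finally show ?thesis
    using Lbar_pos[OF assms] by (simp add: bar.cartan_low_y[OF assms])
qed

text \<open>Lowering with the barred metric leaves only its angular part, by
  \<open>L1_bar_cartan_bar\<close>. Both Cartan tensors expand through \<open>cartan_low_eq\<close>
  with the same L_ijk up to e^sigma, so eliminating it expresses one by the other.\<close>

lemma L2_cartan_bar:
  assumes "p \<in> T"
  shows "(\<Sum>r\<in>UNIV. L2 L i r p * cartan K r j k p) = cartan_low L i j k p / L p
    + (L2 L j k p * mlow L b i p + L2 L i k p * mlow L b j p + L2 L i j p * mlow L b k p) / (2 * K p)"
proof -
  have K: "K p = esig \<sigma> p * L p + beta b p" by (simp add: Lbar_def)
  have pos: "L p \<noteq> 0" "K p \<noteq> 0" "esig \<sigma> p \<noteq> 0"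
    using L_pos[OF assms] Lbar_pos[OF assms] esig_pos[of p] by auto
  \<comment> \<open>The logarithmic vertical derivatives of K and L differ by m_i/K; this is how m
    enters.\<close>
  have m: "L1 K i p / K p - L1 L i p / L p = mlow L b i p / K p" for i
  proof -
    have "L1 K i p * L p - L1 L i p * K p = mlow L b i p * L p"
      using pos by (simp add: L1_bar[OF assms] K mlow_def field_simps)
    then show ?thesis
      using pos by (simp add: field_simps)
  qed
  have "cartan_low K i j k p = (\<Sum>r\<in>UNIV. metric K i r p * cartan K r j k p)"
    unfolding cartan_def by (rule bar.lower_raise[OF assms, symmetric])
  also have "\<dots> = L1 K i p * (\<Sum>r\<in>UNIV. L1 K r p * cartan K r j k p)
      + K p * esig \<sigma> p * (\<Sum>r\<in>UNIV. L2 L i r p * cartan K r j k p)"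
    by (simp add: bar.metric_eq[OF assms] L2_bar[OF assms] sum_expand)
  finally have "2 * K p * esig \<sigma> p * (\<Sum>r\<in>UNIV. L2 L i r p * cartan K r j k p) = 2 * cartan_low K i j k p"
    by (simp add: L1_bar_cartan_bar[OF assms])
  also have "\<dots> = esig \<sigma> p * (L1 K i p * L2 L j k p + L1 K j p * L2 L i k p + L1 K k p * L2 L i j p
      + K p * L3 L i j k p)"
    by (simp add: bar.cartan_low_eq[OF assms] L2_bar[OF assms] L3_bar[OF assms] algebra_simps)
  finally have "esig \<sigma> p * (2 * K p * (\<Sum>r\<in>UNIV. L2 L i r p * cartan K r j k p))
      = esig \<sigma> p * (L1 K i p * L2 L j k p + L1 K j p * L2 L i k p + L1 K k p * L2 L i j p + K p * L3 L i j k p)"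
    by (simp add: mult_ac)
  then have "2 * K p * (\<Sum>r\<in>UNIV. L2 L i r p * cartan K r j k p)
      = L1 K i p * L2 L j k p + L1 K j p * L2 L i k p + L1 K k p * L2 L i j p + K p * L3 L i j k p"
    using pos by simp
  then have "2 * (\<Sum>r\<in>UNIV. L2 L i r p * cartan K r j k p)
      = (L1 K i p / K p) * L2 L j k p + (L1 K j p / K p) * L2 L i k p + (L1 K k p / K p) * L2 L i j p
        + L3 L i j k p"
    using pos by (simp add: field_simps)
  also have "L3 L i j k p = 2 * cartan_low L i j k p / L p - (L1 L i p / L p) * L2 L j k p
      - (L1 L j p / L p) * L2 L i k p - (L1 L k p / L p) * L2 L i j p"
    using cartan_low_eq[OF assms, of i j k] pos by (simp add: field_simps)
  also have "(L1 K i p / K p) * L2 L j k p + (L1 K j p / K p) * L2 L i k p + (L1 K k p / K p) * L2 L i j p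
      + (2 * cartan_low L i j k p / L p - (L1 L i p / L p) * L2 L j k p
      - (L1 L j p / L p) * L2 L i k p - (L1 L k p / L p) * L2 L i j p)
    = 2 * cartan_low L i j k p / L p + (L1 K i p / K p - L1 L i p / L p) * L2 L j k p
      + (L1 K j p / K p - L1 L j p / L p) * L2 L i k p + (L1 K k p / K p - L1 L k p / L p) * L2 L i j p"
    by (simp add: algebra_simps)
  finally have "2 * (\<Sum>r\<in>UNIV. L2 L i r p * cartan K r j k p) = 2 * cartan_low L i j k p / L p
      + mlow L b i p / K p * L2 L j k p + mlow L b j p / K p * L2 L i k p + mlow L b k p / K p * L2 L i j p"
    unfolding m .
  then show ?thesis
    using pos by (simp add: field_simps)
qed

text \<open>\<open>solve_linear_system\<close> with X the barred Cartan tensor and k = 0. Raising Q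
  gives C^i_jk and the first group of terms of \<open>Atens\<close>; the component along L^i gives
  the other two.\<close>

lemma cartan_bar:
  assumes "p \<in> T"
  shows "cartan K i j k p = cartan L i j k p + Atens L \<sigma> b i j k p"
proof -
  define Q where "Q i = cartan_low L i j k p / L p
    + (L2 L j k p * mlow L b i p + L2 L i k p * mlow L b j p + L2 L i j p * mlow L b k p) / (2 * K p)" for i
  have pos: "L p \<noteq> 0" "K p \<noteq> 0" "esig \<sigma> p \<noteq> 0"
    using L_pos[OF assms] Lbar_pos[OF assms] esig_pos[of p] by auto
  have mixed: "angular_mixed L i j p = L p * (\<Sum>r\<in>UNIV. metric_inv L i r p * L2 L r j p)" for i j
    by (simp add: angular_mixed_def angular_def L2_sym[OF assms, of j] sum_distrib_left mult_ac)
  have raise: "L p * (\<Sum>r\<in>UNIV. metric_inv L i r p * Q r) = cartan L i j k p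
      + (angular L j k p * mup L b i p + angular_mixed L i j p * mlow L b k p
        + angular_mixed L i k p * mlow L b j p) / (2 * K p)"
  proof -
    have "(\<Sum>r\<in>UNIV. metric_inv L i r p * Q r) = cartan L i j k p / L p
        + (L2 L j k p * mup L b i p + (\<Sum>r\<in>UNIV. metric_inv L i r p * L2 L r k p) * mlow L b j p
          + (\<Sum>r\<in>UNIV. metric_inv L i r p * L2 L r j p) * mlow L b k p) / (2 * K p)"
      unfolding Q_def cartan_def mup_def
      by (simp add: distrib_left distrib_right add_divide_distrib sum.distrib sum_distrib_left sum_distrib_right
          sum_divide_distrib mult_ac)
    then show ?thesis
      unfolding mixed angular_def using pos by (simp add: field_simps)
  qed
  have "(\<Sum>r\<in>UNIV. bup L b r p * Q r) = (\<Sum>r\<in>UNIV. bup L b r p * cartan_low L r j k p) / L p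
      + (L2 L j k p * (\<Sum>r\<in>UNIV. bup L b r p * mlow L b r p)
        + (\<Sum>r\<in>UNIV. bup L b r p * L2 L r k p) * mlow L b j p
        + (\<Sum>r\<in>UNIV. bup L b r p * L2 L r j p) * mlow L b k p) / (2 * K p)"
    unfolding Q_def
    by (simp add: distrib_left distrib_right add_divide_distrib sum.distrib sum_distrib_left sum_distrib_right
        sum_divide_distrib mult_ac)
  then have beta: "L p * (\<Sum>r\<in>UNIV. bup L b r p * Q r) = (\<Sum>r\<in>UNIV. bup L b r p * cartan_low L r j k p)
      + (angular L j k p * msq L b p + 2 * mlow L b j p * mlow L b k p) / (2 * K p)"
    unfolding bup_mlow[OF assms] unfolding bup_L2[OF assms, symmetric] angular_def
    using pos by (simp add: field_simps)
  have C: "(\<Sum>s\<in>UNIV. cartan_low L j k s p * Lup L i p * bup L b s p)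
      = (\<Sum>r\<in>UNIV. bup L b r p * cartan_low L r j k p) * Lup L i p"
  proof -
    have "cartan_low L j k s p = cartan_low L s j k p" for s
      using cartan_low_sym12[OF assms, of s j k] cartan_low_sym23[OF assms, of j s k] by simp
    then show ?thesis
      by (simp add: sum_distrib_left sum_distrib_right mult_ac)
  qed
  have "cartan K i j k p = L p * (\<Sum>r\<in>UNIV. metric_inv L i r p * Q r)
      + L p / K p * (0 - L p * (\<Sum>i\<in>UNIV. bup L b i p * Q i)) * Lup L i p"
    by (rule solve_linear_system[OF assms _ L1_bar_cartan_bar[OF assms]])
      (simp add: Q_def L2_cartan_bar[OF assms])
  \<comment> \<open>The coefficient L/K comes from \<open>solve_linear_system\<close>; written with
    tau it is e^sigma/tau.\<close>
  moreover have "esig \<sigma> p / tau L \<sigma> b p = L p / K p"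
    "esig \<sigma> p / (2 * K p * tau L \<sigma> b p) = L p / K p / (2 * K p)"
    using pos by (simp_all add: tau_def field_simps)
  ultimately show ?thesis
    unfolding raise beta Atens_def C by (simp add: algebra_simps add_divide_distrib diff_divide_distrib)
qed

section \<open>The torsions P and R\<close>

lemma Ptors_bar:
  assumes "p \<in> T"
  shows "Ptors K i j k p = Ptors L i j k p - D i j k p + Btens L \<sigma> b i j k p"
proof -
  have "dy k (nonlin K i j) p = dy k (\<lambda>q. nonlin L i j q + D0 i j q) p"
    by (rule dy_cong[OF assms nonlin_bar])
  also have "\<dots> = dy k (nonlin L i j) p + dy k (D0 i j) p"
    unfolding dy_def using assms by (intro dird_add) auto
  finally show ?thesis
    by (simp add: Ptors_def Diff_def Btens_def)
qed

lemma Rtors_bar: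
  assumes "p \<in> T"
  shows "Rtors K i j k p = Rtors L i j k p + alternate (\<lambda>j k. hcov L D0 i j k p
    - (\<Sum>r\<in>UNIV. (Btens L \<sigma> b i j r p + Ptors L i j r p) * D0 r k p)) j k"
proof -
  have N: "hderiv K k (nonlin K i j) p = hderiv L k (nonlin L i j) p + hderiv L k (D0 i j) p
      - (\<Sum>r\<in>UNIV. (dy r (nonlin L i j) p + dy r (D0 i j) p) * D0 r k p)" for j k
  proof -
    have "hderiv K k (nonlin K i j) p = hderiv K k (\<lambda>q. nonlin L i j q + D0 i j q) p"
      by (rule hderiv_cong[OF assms nonlin_bar])
    also have "\<dots> = hderiv K k (nonlin L i j) p + hderiv K k (D0 i j) p"
      using assms by (simp add: hderiv_add)
    finally show ?thesis
      by (simp add: hderiv_bar[OF assms] distrib_right sum.distrib)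
  qed
  \<comment> \<open>Since P contains -Gamma, the product P D_0 supplies D^r_0k Gamma^i_jr, the
    mirror image of the term D^r_0j Gamma^i_kr in \<open>hcov\<close>. Their sum and the last term
    are symmetric in j and k, so alternation leaves only the derivatives of N and D_0.\<close>
  have Q: "hcov L D0 i j k p - (\<Sum>r\<in>UNIV. (Btens L \<sigma> b i j r p + Ptors L i j r p) * D0 r k p)
      = hderiv L k (D0 i j) p - (\<Sum>r\<in>UNIV. (dy r (nonlin L i j) p + dy r (D0 i j) p) * D0 r k p)
        + (\<Sum>r\<in>UNIV. D0 r j p * Gam L i k r p) + (\<Sum>r\<in>UNIV. D0 r k p * Gam L i j r p)
        - (\<Sum>r\<in>UNIV. D0 i r p * Gam L r j k p)" for j k
    by (simp add: hcov_def Btens_def Ptors_def Gam_sym[OF assms, of i _ k] distrib_right left_diff_distrib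
        distrib_left right_diff_distrib sum.distrib sum_subtractf mult.commute)
  have "(\<Sum>r\<in>UNIV. D0 i r p * Gam L r k j p) = (\<Sum>r\<in>UNIV. D0 i r p * Gam L r j k p)"
    by (simp add: Gam_sym[OF assms, of _ k j])
  then show ?thesis
    unfolding Rtors_def alternate_def N Q by simp
qed

end

section \<open>Passage to charts\<close>

lemma finsler_metric_domain:
  assumes "smooth_manifold \<A>" "finsler_metric \<A> L" "c \<in> \<A>"
  shows "finsler_domain (chart_image c) (L c)"
proof
  show "open (chart_image c)"
    using assms by (simp add: smooth_manifold_def)
qed (use assms in \<open>auto simp: finsler_metric_def\<close>)

theorem proposition4p4:
  fixes \<A> :: "('m::{t2_space, second_countable_topology}, 'n::finite) chart set"
    and L L' :: "('m, 'n) chart \<Rightarrow> 'n scalar"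
    and \<sigma> :: "'m \<Rightarrow> real"
    and b :: "('m, 'n) chart \<Rightarrow> real ^ 'n \<Rightarrow> real ^ 'n"
  assumes "smooth_manifold \<A>"
    and "finsler_metric \<A> L"
    and "smooth_function \<A> \<sigma>"
    and "smooth_one_form \<A> b"
    and "L' = beta_conformal_change \<sigma> b L"
    and "finsler_metric \<A> L'"
  shows "\<forall>c\<in>\<A>. \<forall>x\<in>chart_image c. \<forall>y. y \<noteq> 0 \<longrightarrow>
    (let l = L c; l' = L' c; s = in_chart \<sigma> c; w = b c; p = (x, y);
         D = Diff l s w; D0 = Diff0 l s w; D00 = Diff00 l s w; B = Btens l s w in
     (\<forall>i j k. cartan l' i j k p = cartan l i j k p + Atens l s w i j k p) \<and>
     (\<forall>i j k. Ptors l' i j k p = Ptors l i j k p - D i j k p + B i j k p) \<and>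
     (\<forall>i j k. Rtors l' i j k p = Rtors l i j k p +
        alternate (\<lambda>j k. hcov l D0 i j k p
          - (\<Sum>r\<in>UNIV. (B i j r p + Ptors l i j r p) * D0 r k p)) j k) \<and>
     (\<forall>i j k. D i j k p = Diff_expr l s w i j k p) \<and>
     (\<forall>i j. D0 i j p = Diff0_expr l s w i j p) \<and>
     (\<forall>r. D00 r p = Diff00_expr l s w r p))"
proof (intro ballI allI impI)
  fix c x and y :: "real ^ 'n"
  assume c: "c \<in> \<A>" and x: "x \<in> chart_image c" and y: "y \<noteq> 0"
  let ?s = "in_chart \<sigma> c" and ?p = "(x, y)"
  have L': "L' c = Lbar (L c) ?s (b c)"
    using assms(5) by (simp add: beta_conformal_change_def)
  interpret beta_change "chart_image c" "L c" ?s "b c"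
  proof (rule beta_change.intro)
    show "finsler_domain (chart_image c) (L c)"
      using assms(1,2) c by (rule finsler_metric_domain)
    show "finsler_domain (chart_image c) (Lbar (L c) ?s (b c))"
      using finsler_metric_domain[OF assms(1,6) c] L' by simp
    show "beta_change_axioms (chart_image c) ?s (b c)"
      using assms(3,4) c
      by (simp add: beta_change_axioms_def smooth_function_def smooth_one_form_def)
  qed
  have p: "?p \<in> T"
    using x y by (simp add: T_def)
  show "let l = L c; l' = L' c; s = ?s; w = b c; p = ?p;
         D = Diff l s w; D0 = Diff0 l s w; D00 = Diff00 l s w; B = Btens l s w in
     (\<forall>i j k. cartan l' i j k p = cartan l i j k p + Atens l s w i j k p) \<and>
     (\<forall>i j k. Ptors l' i j k p = Ptors l i j k p - D i j k p + B i j k p) \<and>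
     (\<forall>i j k. Rtors l' i j k p = Rtors l i j k p +
        alternate (\<lambda>j k. hcov l D0 i j k p
          - (\<Sum>r\<in>UNIV. (B i j r p + Ptors l i j r p) * D0 r k p)) j k) \<and>
     (\<forall>i j k. D i j k p = Diff_expr l s w i j k p) \<and>
     (\<forall>i j. D0 i j p = Diff0_expr l s w i j p) \<and>
     (\<forall>r. D00 r p = Diff00_expr l s w r p)"
    unfolding Let_def L'
    using cartan_bar[OF p] Ptors_bar[OF p] Rtors_bar[OF p] Diff_formula[OF p] Diff0_formula[OF p]
      Diff00_formula[OF p] by blast
qed

end
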